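(* Let $K$ be one of $\mathcal{M}(\mathbf{C})$, $\mathbf{C}(\{z\})$, $\mathbf{C}((z))$, let $0\ne P\in\mathcal{D}_{q,K}$ and let $\mu\in\mathbf{Z}$ be a slope of $P$. Let $c_1,\ldots,c_p$ be the (distinct) exponents attached to the slope $\mu$, and $m_1,\ldots,m_p$ their respective multiplicities. Suppose the $c_i$ are indexed so that if $c_j/c_i=q^{l}$ with $l\in\mathbf{N}^*$, then $i<j$. Then there is a factorization $P=QR$ in $\mathcal{D}_{q,\mathbf{C}((z))}$ with $\mu\notin S(Q)$ and $R=R_1\cdots R_p$, where $$\forall i\in\{1,\ldots,p\},\quad R_i=(z^{\mu}\sigma_q-c_i)\,u_{i,m_i}^{-1}\cdots(z^{\mu}\sigma_q-c_i)\,u_{i,1}^{-1},$$ the $u_{i,j}$ being formal power series in $z$ with $u_{i,j}(0)=1$. Moreover $r_R=(m_1+\cdots+m_p)\delta_\mu$ and $\overline{R}^{(\mu)}=\prod_{i=1}^p(X-c_i)^{m_i}$.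
   Context: Fix $q\in\mathbf{C}$ with $|q|>1$. $\mathcal{M}(\mathbf{C})$ is the field of meromorphic functions on $\mathbf{C}$, $\mathbf{C}(\{z\})$ the field of germs of meromorphic functions at $0$, and $\mathbf{C}((z))$ the field of formal Laurent series; $\mathcal{M}(\mathbf{C})\subset\mathbf{C}(\{z\})\subset\mathbf{C}((z))$ via Laurent expansion at $0$. $v_0$ is the $z$-adic valuation and $\sigma_q$ the automorphism $f(z)\mapsto f(qz)$. For such a field $K$, $\mathcal{D}_{q,K}=K\langle\sigma_q,\sigma_q^{-1}\rangle$ is the ring of non-commutative Laurent polynomials $\sum a_i\sigma_q^i$ with $\sigma_q^k x=\sigma_q^k(x)\sigma_q^k$ ($x\in K$, $k\in\mathbf{Z}$); elements $u\in K$ are viewed as operators of degree $0$ (multiplication). Newton polygon: for $0\neq P=\sum a_i\sigma_q^i\in\mathcal{D}_{q,K}$, $N(P)$ is the convex hull of $\{(i,j)\in\mathbf{Z}^2: j\ge v_0(a_i)\}$. Its boundary consists of two vertical half-lines and vectors $(r_1,d_1),\ldots,(r_k,d_k)\in\mathbf{N}^*\times\mathbf{Z}$ of slopes $\mu_i=d_i/r_i$, with $\mu_1<\cdots<\mu_k$. $S(P)=\{\mu_1,\ldots,\mu_k\}$ is the set of slopes, and $r_P=\sum_i r_i\delta_{\mu_i}:\mathbf{Q}\to\mathbf{N}$, where $\delta_\mu$ is the indicator function of $\{\mu\}$. Characteristic polynomial: for $\mu\in\mathbf{Z}$ put $P'=\sum a_i'\sigma_q^i$ with $a_i'=a_i\,q^{-\mu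 i(i-1)/2}z^{-\mu i}$, let $\ell=\min_i v_0(a_i')$ and $b_i=z^{-\ell}a_i'$. Then $\overline{P}^{(\mu)}(s)=\sum_i b_i(0)s^i\in\mathbf{C}[s,s^{-1}]$, considered as defined up to a factor $\lambda s^k$, $\lambda\in\mathbf{C}^*$, $k\in\mathbf{Z}$ (identities between characteristic polynomials are understood up to such factors). The exponents attached to the slope $\mu$ are the non-zero roots of $\overline{P}^{(\mu)}$, with their multiplicities as roots. *)

theory Defs
  imports
    "HOL-Complex_Analysis.Complex_Analysis"
    "HOL-Library.Poly_Mapping"
    "HOL-Algebra.Ring"
begin

section \<open>The three coefficient fields, as subfields of the formal Laurent series\<close>

definition meromorphic_fls :: "complex fls set" where
  "meromorphic_fls = {F. \<exists>f. f meromorphic_on UNIV \<and> f has_laurent_expansion F}"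

definition germ_fls :: "complex fls set" where
  "germ_fls = {F. \<exists>f U. open U \<and> 0 \<in> U \<and> f meromorphic_on U \<and> f has_laurent_expansion F}"

section \<open>The ring of non-commutative Laurent polynomials\<close>

text \<open>The \<open>k\<close>-th iterate of \<open>f(z) \<mapsto> f(q z)\<close>, namely \<open>f(z) \<mapsto> f(q\<^sup>k z)\<close>.\<close>

definition sigma_pow :: "complex \<Rightarrow> int \<Rightarrow> complex fls \<Rightarrow> complex fls" where
  "sigma_pow q k F = fls_compose_fps F (fps_const (q powi k) * fps_X)"

text \<open>
  The operator with coefficients \<open>a\<^sub>i\<close> is the finitely supported function \<open>i \<mapsto> a\<^sub>i\<close>.  The
  multiplication that \<^type>\<open>poly_mapping\<close> carries by default is the commutative one; the twisted
  multiplication is that of the ring \<open>skew_laurent\<close> below.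
\<close>

type_synonym qop = "int \<Rightarrow>\<^sub>0 complex fls"

definition qop_mult :: "complex \<Rightarrow> qop \<Rightarrow> qop \<Rightarrow> qop" where
  "qop_mult q P Q =
     (\<Sum>i\<in>Poly_Mapping.keys P. \<Sum>j\<in>Poly_Mapping.keys Q.
        Poly_Mapping.single (i + j)
          (Poly_Mapping.lookup P i * sigma_pow q i (Poly_Mapping.lookup Q j)))"

definition skew_laurent :: "complex \<Rightarrow> complex fls set \<Rightarrow> qop ring" where
  "skew_laurent q K =
     \<lparr> carrier = {P. \<forall>i. Poly_Mapping.lookup P i \<in> K},
       mult = qop_mult q,
       one = Poly_Mapping.single 0 1,
       zero = 0,
       add = (+) \<rparr>"

definition qop_const :: "complex fls \<Rightarrow> qop" where
  "qop_const a = Poly_Mapping.single 0 a"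

text \<open>The operator \<open>z\<^sup>\<mu> \<sigma>\<^sub>q - c\<close>.\<close>

definition qop_linear :: "int \<Rightarrow> complex \<Rightarrow> qop" where
  "qop_linear \<mu> c = Poly_Mapping.single 1 (fls_X powi \<mu>) - qop_const (fls_const c)"

text \<open>The product of a list of ring elements, in the order of the list.\<close>

definition ordered_prod :: "('a, 'b) monoid_scheme \<Rightarrow> 'a list \<Rightarrow> 'a" where
  "ordered_prod G xs = foldr (mult G) xs \<one>\<^bsub>G\<^esub>"

section \<open>The Newton polygon\<close>

definition newton_polygon :: "qop \<Rightarrow> (real \<times> real) set" where
  "newton_polygon P =
     convex hull {(real_of_int i, real_of_int j) | i j.
       Poly_Mapping.lookup P i \<noteq> 0 \<and> fls_subdegree (Poly_Mapping.lookup P i) \<le> j}"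

text \<open>
  The pairs \<open>(r\<^sub>i, d\<^sub>i)\<close>: the non-vertical edges of the polygon, as vectors directed to the right.
  Their end points are vertices of the polygon, so that restricting to integral vectors loses
  nothing.  Distinct edges have distinct slopes, so that a set of vectors loses nothing either.
\<close>

definition newton_vectors :: "qop \<Rightarrow> (nat \<times> int) set" where
  "newton_vectors P =
     {(r, d). r > 0 \<and>
        (\<exists>x y. closed_segment (x, y) (x + real r, y + real_of_int d) edge_of newton_polygon P)}"

definition newton_slopes :: "qop \<Rightarrow> rat set" where
  "newton_slopes P = {of_int d / of_nat r | r d. (r, d) \<in> newton_vectors P}"

definition newton_fun :: "qop \<Rightarrow> rat \<Rightarrow> nat" where
  "newton_fun P = (\<lambda>\<nu>. \<Sum>(r, d)\<in>newton_vectors P. if \<nu> = of_int d / of_nat r then r else 0)"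

section \<open>Characteristic polynomials and exponents\<close>

text \<open>
  \<open>\<complex>[s, s\<inverse>]\<close> is \<^typ>\<open>int \<Rightarrow>\<^sub>0 complex\<close> with its library ring structure (convolution).
\<close>

type_synonym lpoly = "int \<Rightarrow>\<^sub>0 complex"

definition twisted_coeff :: "complex \<Rightarrow> int \<Rightarrow> qop \<Rightarrow> int \<Rightarrow> complex fls" where
  "twisted_coeff q \<mu> P i =
     Poly_Mapping.lookup P i * fls_const (q powi (- (\<mu> * (i * (i - 1) div 2)))) * fls_X powi (- (\<mu> * i))"

definition twisted_val :: "complex \<Rightarrow> int \<Rightarrow> qop \<Rightarrow> int" where
  "twisted_val q \<mu> P =
     Min ((\<lambda>i. fls_subdegree (twisted_coeff q \<mu> P i)) ` Poly_Mapping.keys P)"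

definition char_lpoly :: "complex \<Rightarrow> int \<Rightarrow> qop \<Rightarrow> lpoly" where
  "char_lpoly q \<mu> P =
     (\<Sum>i\<in>Poly_Mapping.keys P.
        Poly_Mapping.single i
          (fls_nth (fls_X powi (- twisted_val q \<mu> P) * twisted_coeff q \<mu> P i) 0))"

text \<open>Equality up to a factor \<open>\<lambda> s\<^sup>k\<close> with \<open>\<lambda> \<noteq> 0\<close>.\<close>

definition lpoly_eq_upto :: "lpoly \<Rightarrow> lpoly \<Rightarrow> bool" where
  "lpoly_eq_upto f g \<longleftrightarrow> (\<exists>a k. a \<noteq> 0 \<and> f = Poly_Mapping.single k a * g)"

definition lpoly_X :: lpoly where
  "lpoly_X = Poly_Mapping.single 1 1"

definition lpoly_const :: "complex \<Rightarrow> lpoly" where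
  "lpoly_const a = Poly_Mapping.single 0 a"

text \<open>
  The representative \<open>s\<^sup>k f\<close> of the class of \<open>f\<close> that is a polynomial with non-zero constant term.
  All other representatives have the same non-zero roots, with the same multiplicities.
\<close>

definition lpoly_to_poly :: "lpoly \<Rightarrow> complex poly" where
  "lpoly_to_poly f =
     (\<Sum>i\<in>Poly_Mapping.keys f.
        monom (Poly_Mapping.lookup f i) (nat (i - Min (Poly_Mapping.keys f))))"

definition exponents :: "complex \<Rightarrow> int \<Rightarrow> qop \<Rightarrow> complex set" where
  "exponents q \<mu> P = {c. c \<noteq> 0 \<and> poly (lpoly_to_poly (char_lpoly q \<mu> P)) c = 0}"

definition exponent_mult :: "complex \<Rightarrow> int \<Rightarrow> qop \<Rightarrow> complex \<Rightarrow> nat" where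
  "exponent_mult q \<mu> P c = Polynomial.order c (lpoly_to_poly (char_lpoly q \<mu> P))"

section \<open>\<open>skew_laurent\<close> is a ring\<close>

lemma sigma_pow_nth:
  assumes "q \<noteq> 0"
  shows "fls_nth (sigma_pow q k F) n = (q powi k) powi n * fls_nth F n"
proof -
  let ?c = "q powi k" and ?G = "fps_const (q powi k) * fps_X :: complex fps"
  have c: "?c \<noteq> 0" using assms by simp
  have G: "fps_to_fls ?G = fls_const ?c * fls_X"
    by (simp add: fls_times_fps_to_fls)
  have cp: "fls_const a powi m = fls_const (a powi m)" for a :: complex and m
    by (cases "m \<ge> 0") (simp_all add: power_int_def fls_const_power fls_inverse_const)
  have X: "H * (C * fls_X_intpow i) = C * fls_shift (- i) H" for H C :: "complex fls" and i
  proof -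
    have "H * (C * fls_X_intpow i) = C * (fls_X_intpow i * H)"
      by (simp only: mult_ac)
    then show ?thesis by (simp only: fls_X_intpow_times_conv_shift(1))
  qed
  have "sigma_pow q k F =
      fps_to_fls (fps_compose (fls_base_factor_to_fps F) ?G) * fps_to_fls ?G powi fls_subdegree F"
    by (simp add: sigma_pow_def fls_compose_fps_def)
  also have "fps_compose (fls_base_factor_to_fps F) ?G =
      Abs_fps (\<lambda>n. ?c ^ n * fls_base_factor_to_fps F $ n)"
    by (rule fps_compose_linear)
  also have "fps_to_fls ?G powi fls_subdegree F
      = fls_const (?c powi fls_subdegree F) * fls_X_intpow (fls_subdegree F)"
    by (simp add: G power_int_mult_distrib cp fls_X_power_int)
  also have "fps_to_fls (Abs_fps (\<lambda>n. ?c ^ n * fls_base_factor_to_fps F $ n)) * \<dots> =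
      fls_const (?c powi fls_subdegree F) *
        fls_shift (- fls_subdegree F) (fps_to_fls (Abs_fps (\<lambda>n. ?c ^ n * fls_base_factor_to_fps F $ n)))"
    by (rule X)
  finally have *: "sigma_pow q k F = \<dots>" .
  show ?thesis
  proof (cases "n \<ge> fls_subdegree F")
    case True
    have "?c powi fls_subdegree F * ?c ^ nat (n - fls_subdegree F) = ?c powi n"
      using True c by (simp flip: power_int_of_nat power_int_add)
    with True show ?thesis
      by (simp add: * fls_base_factor_to_fps_nth)
  next
    case False
    then show ?thesis by (simp add: *)
  qed
qed

lemma sigma_pow_0 [simp]: "sigma_pow q k 0 = 0"
  and sigma_pow_1 [simp]: "sigma_pow q k 1 = 1"
  by (simp_all add: sigma_pow_def)

lemma sigma_pow_add: "q \<noteq> 0 \<Longrightarrow> sigma_pow q k (F + G) = sigma_pow q k F + sigma_pow q k G"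
  by (simp add: sigma_pow_def fls_compose_fps_add)

lemma sigma_pow_mult: "q \<noteq> 0 \<Longrightarrow> sigma_pow q k (F * G) = sigma_pow q k F * sigma_pow q k G"
  by (simp add: sigma_pow_def fls_compose_fps_mult)

lemma sigma_pow_sigma_pow: "q \<noteq> 0 \<Longrightarrow> sigma_pow q i (sigma_pow q j F) = sigma_pow q (i + j) F"
  by (rule fls_eqI) (simp add: sigma_pow_nth power_int_add power_int_mult_distrib)

lemma sigma_pow_zero: "q \<noteq> 0 \<Longrightarrow> sigma_pow q 0 F = F"
  by (rule fls_eqI) (simp add: sigma_pow_nth)

lemma qop_mult_superset:
  assumes "finite A" "Poly_Mapping.keys P \<subseteq> A" "finite B" "Poly_Mapping.keys Q \<subseteq> B"
  shows "qop_mult q P Q = (\<Sum>i\<in>A. \<Sum>j\<in>B. Poly_Mapping.single (i + j)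
           (Poly_Mapping.lookup P i * sigma_pow q i (Poly_Mapping.lookup Q j)))"
proof -
  have "qop_mult q P Q = (\<Sum>i\<in>Poly_Mapping.keys P. \<Sum>j\<in>B. Poly_Mapping.single (i + j)
           (Poly_Mapping.lookup P i * sigma_pow q i (Poly_Mapping.lookup Q j)))"
    unfolding qop_mult_def using assms
    by (intro sum.cong refl sum.mono_neutral_left) (auto simp: in_keys_iff)
  also have "\<dots> = (\<Sum>i\<in>A. \<Sum>j\<in>B. Poly_Mapping.single (i + j)
           (Poly_Mapping.lookup P i * sigma_pow q i (Poly_Mapping.lookup Q j)))"
    using assms by (intro sum.mono_neutral_left) (auto simp: in_keys_iff)
  finally show ?thesis .
qed

lemma qop_mult_zero [simp]: "qop_mult q 0 Q = 0" "qop_mult q P 0 = 0"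
  by (simp_all add: qop_mult_def)

lemma qop_mult_add_left: "qop_mult q (P + P') Q = qop_mult q P Q + qop_mult q P' Q"
proof -
  let ?A = "Poly_Mapping.keys P \<union> Poly_Mapping.keys P'" and ?B = "Poly_Mapping.keys Q"
  have "Poly_Mapping.keys (P + P') \<subseteq> ?A" by (rule Poly_Mapping.keys_add)
  then show ?thesis
    by (simp add: qop_mult_superset[of ?A _ ?B] lookup_add algebra_simps single_add sum.distrib)
qed

lemma qop_mult_add_right:
  "q \<noteq> 0 \<Longrightarrow> qop_mult q P (Q + Q') = qop_mult q P Q + qop_mult q P Q'"
proof -
  assume q: "q \<noteq> 0"
  let ?A = "Poly_Mapping.keys P" and ?B = "Poly_Mapping.keys Q \<union> Poly_Mapping.keys Q'"
  have "Poly_Mapping.keys (Q + Q') \<subseteq> ?B" by (rule Poly_Mapping.keys_add)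
  then show ?thesis
    by (simp add: qop_mult_superset[of ?A _ ?B] lookup_add algebra_simps single_add sum.distrib
        sigma_pow_add q)
qed

lemma qop_mult_single:
  "qop_mult q (Poly_Mapping.single i a) (Poly_Mapping.single j b) =
     Poly_Mapping.single (i + j) (a * sigma_pow q i b)"
  by (subst qop_mult_superset[of "{i}" _ "{j}"]) auto

lemma poly_mapping_sum_single:
  "(\<Sum>i\<in>Poly_Mapping.keys P. Poly_Mapping.single i (Poly_Mapping.lookup P i)) = P"
proof (rule poly_mapping_eqI)
  fix k
  have "(\<Sum>i\<in>A. Poly_Mapping.lookup (Poly_Mapping.single i (Poly_Mapping.lookup P i)) k) =
      (if k \<in> A then Poly_Mapping.lookup P k else 0)" if "finite A" for A
    using that by (induction A) (auto simp: lookup_single when_def)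
  from this[OF finite_keys[of P]] show
    "Poly_Mapping.lookup (\<Sum>i\<in>Poly_Mapping.keys P.
       Poly_Mapping.single i (Poly_Mapping.lookup P i)) k = Poly_Mapping.lookup P k"
    by (auto simp: lookup_sum in_keys_iff)
qed

lemma qop_induct [case_names zero add]:
  assumes "Pr (0 :: qop)" "\<And>i a P. Pr P \<Longrightarrow> Pr (Poly_Mapping.single i a + P)"
  shows "Pr P"
proof -
  have "Pr (\<Sum>i\<in>A. Poly_Mapping.single i (Poly_Mapping.lookup P i))" if "finite A" for A
    using that by (induction A) (auto intro: assms)
  from this[of "Poly_Mapping.keys P"] show ?thesis
    by (simp add: poly_mapping_sum_single)
qed

lemma qop_mult_assoc:
  assumes q: "q \<noteq> 0"
  shows "qop_mult q (qop_mult q P Q) R = qop_mult q P (qop_mult q Q R)"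
proof (induction P rule: qop_induct)
  case (add i a P)
  have "qop_mult q (qop_mult q (Poly_Mapping.single i a) Q) R =
        qop_mult q (Poly_Mapping.single i a) (qop_mult q Q R)"
  proof (induction Q rule: qop_induct)
    case (add j b Q)
    have "qop_mult q (qop_mult q (Poly_Mapping.single i a) (Poly_Mapping.single j b)) R =
        qop_mult q (Poly_Mapping.single i a) (qop_mult q (Poly_Mapping.single j b) R)"
      by (induction R rule: qop_induct)
        (simp_all add: qop_mult_add_right q qop_mult_single sigma_pow_mult sigma_pow_sigma_pow
          add.assoc mult.assoc)
    with add show ?case by (simp add: qop_mult_add_left qop_mult_add_right q)
  qed simp
  with add show ?case by (simp add: qop_mult_add_left)
qed simp

lemma qop_mult_one:
  assumes "q \<noteq> 0"
  shows "qop_mult q (Poly_Mapping.single 0 1) P = P" "qop_mult q P (Poly_Mapping.single 0 1) = P"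
  using assms
  by (induction P rule: qop_induct)
    (simp_all add: qop_mult_add_left qop_mult_add_right qop_mult_single sigma_pow_zero
      del: single_one)

lemma ring_skew_laurent:
  assumes q: "q \<noteq> 0"
    and K: "0 \<in> K" "1 \<in> K" "\<And>a b. a \<in> K \<Longrightarrow> b \<in> K \<Longrightarrow> a + b \<in> K" "\<And>a. a \<in> K \<Longrightarrow> - a \<in> K"
      "\<And>a b. a \<in> K \<Longrightarrow> b \<in> K \<Longrightarrow> a * b \<in> K" "\<And>a k. a \<in> K \<Longrightarrow> sigma_pow q k a \<in> K"
  shows "ring (skew_laurent q K)"
proof (rule ringI)
  show "abelian_group (skew_laurent q K)"
  proof (rule abelian_groupI)
    fix x assume "x \<in> carrier (skew_laurent q K)"
    then show "\<exists>y\<in>carrier (skew_laurent q K). y \<oplus>\<^bsub>skew_laurent q K\<^esub> x = \<zero>\<^bsub>skew_laurent q K\<^esub>"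
      by (intro bexI[of _ "- x"]) (auto simp: skew_laurent_def K)
  qed (auto simp: skew_laurent_def lookup_add K add_ac)
  have S: "Poly_Mapping.lookup (\<Sum>x\<in>A. f x) i \<in> K"
    if "\<And>x. x \<in> A \<Longrightarrow> Poly_Mapping.lookup (f x) i \<in> K" for A :: "int set" and f :: "int \<Rightarrow> qop" and i
    using that by (induction A rule: infinite_finite_induct) (auto simp: lookup_add K)
  show "monoid (skew_laurent q K)"
  proof (rule monoidI)
    fix x y assume "x \<in> carrier (skew_laurent q K)" "y \<in> carrier (skew_laurent q K)"
    then show "x \<otimes>\<^bsub>skew_laurent q K\<^esub> y \<in> carrier (skew_laurent q K)"
      by (auto simp: skew_laurent_def qop_mult_def lookup_single when_def K intro!: S)
  qed (auto simp: skew_laurent_def lookup_single when_def K qop_mult_assoc qop_mult_one q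
      simp del: single_one)
qed (auto simp: skew_laurent_def qop_mult_add_left qop_mult_add_right q)

end

theory Submission
  imports
    Defs
    "HOL-Computational_Algebra.Fundamental_Theorem_Algebra"
begin

text \<open>
  Write \<open>P = \<Sum> a'\<^sub>i \<tau>\<^sup>i\<close> with \<open>\<tau> = z\<^sup>\<mu> \<sigma>\<^sub>q\<close>. Then \<open>\<tau> - c\<close> divides \<open>P u\<close> on the right as soon as
  \<open>\<Sum> a'\<^sub>i c\<^sup>i \<sigma>\<^sub>q\<^sup>i(u) = 0\<close>. For a power series \<open>u\<close> with \<open>u(0) = 1\<close> this is a triangular system whose
  diagonal entries are the values of the characteristic polynomial at \<open>c q\<^sup>n\<close>. It is solvable if \<open>c\<close>
  is an exponent and no \<open>c q\<^sup>n\<close> with \<open>n > 0\<close> is one; the numbering of the exponents guarantees this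
  when the factors are split off from the right, starting with \<open>c\<^sub>p\<close>. Each step divides the
  characteristic polynomial by \<open>X - c\<close>, and in the end it is a monomial, so that \<open>\<mu>\<close> is no longer a
  slope.
\<close>

section \<open>Twisted coefficients\<close>

text \<open>The divisibility criterion comes from two facts: \<tau>^i u = \<sigma>^i(u) \<tau>^i,
  and \<tau>^i is congruent to c^i modulo the left ideal generated by \<tau> - c, also for negative
  i because c is non-zero. The sum in the criterion is thus the remainder of P u, and undoing the
  multiplication by u puts the inverse of u to the right of \<tau> - c. A multiple exponent does not
  obstruct itself, since norm q > 1 excludes c q^n = c. The passage from characteristic polynomials
  to slopes is convex geometry. The polygon lies above a line of slope \<mu>, and its generators on
  that line sit over the support of the characteristic polynomial. A monomial leaves a single point
  of contact, hence no edge. For R, of degree at most M and with non-zero initial coefficients at 0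
  and M, the polygon is the part of a strip above one segment. As edges are defined as
  one-dimensional faces of an unbounded convex set, it has to be shown that the line of a
  non-vertical edge supports the polygon; closure under upward translation gives this.\<close>

lemma fls_nth_mult_X_power_int: "fls_nth (F * fls_X powi k) n = fls_nth F (n - k)"
  for F :: "complex fls"
  by (simp only: fls_X_power_int fls_X_intpow_times_conv_shift(2) fls_shift_nth) simp

lemma sigma_pow_const [simp]: "q \<noteq> 0 \<Longrightarrow> sigma_pow q k (fls_const a) = fls_const a"
  by (rule fls_eqI) (auto simp: sigma_pow_nth)

lemma sigma_pow_X_power_int:
  "q \<noteq> 0 \<Longrightarrow> sigma_pow q k (fls_X powi n) = fls_const (q powi (k * n)) * fls_X powi n"
  by (rule fls_eqI) (auto simp: sigma_pow_nth power_int_mult simp flip: fls_const_mult_const)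

text \<open>The cross term matches the power of \<open>q\<close> that arises when \<sigma>^i moves
  past z^(\<mu> j). This is why the normalization by triangular numbers is compatible with
  products.\<close>

lemma triangular_add:
  "(i + j) * (i + j - 1) div 2 = i * (i - 1) div 2 + j * (j - 1) div 2 + i * j" for i j :: int
proof -
  have "even (k * (k - 1))" for k :: int by simp
  then have "2 * (k * (k - 1) div 2) = k * (k - 1)" for k :: int
    by (metis dvd_mult_div_cancel)
  note this[of i] this[of j] this[of "i + j"]
  moreover have "(i + j) * (i + j - 1) = i * (i - 1) + j * (j - 1) + 2 * (i * j)"
    by (simp add: algebra_simps)
  ultimately show ?thesis by linarith
qed

lemma twisted_coeff_nth:
  "fls_nth (twisted_coeff q \<mu> P i) n =
     q powi (- (\<mu> * (i * (i - 1) div 2))) * fls_nth (Poly_Mapping.lookup P i) (n + \<mu> * i)"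
  by (simp add: twisted_coeff_def fls_nth_mult_X_power_int del: fls_X_power_int)

lemma twisted_coeff_sum:
  "twisted_coeff q \<mu> (\<Sum>x\<in>A. f x) i = (\<Sum>x\<in>A. twisted_coeff q \<mu> (f x) i)"
  by (simp add: twisted_coeff_def lookup_sum sum_distrib_right)

lemma twisted_coeff_eq_0_iff:
  "q \<noteq> 0 \<Longrightarrow> twisted_coeff q \<mu> P i = 0 \<longleftrightarrow> Poly_Mapping.lookup P i = 0"
  by (simp add: twisted_coeff_def fls_const_nonzero del: fls_X_power_int)

lemma twisted_coeff_single:
  "twisted_coeff q \<mu> (Poly_Mapping.single k a) i =
     (if i = k then twisted_coeff q \<mu> (Poly_Mapping.single k a) k else 0)"
  by (simp add: twisted_coeff_def lookup_single when_def)

text \<open>Powers of \<tau> multiply like powers of \<sigma>: (a \<tau>^i)(b \<tau>^j) = a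
  \<sigma>^i(b) \<tau>^(i+j), so the twisted coefficients obey the same product rule as the original
  ones.\<close>

lemma twisted_coeff_single_mult:
  assumes "q \<noteq> 0"
  shows "twisted_coeff q \<mu> (Poly_Mapping.single (i + j)
           (Poly_Mapping.lookup P i * sigma_pow q i (Poly_Mapping.lookup Q j))) (i + j) =
         twisted_coeff q \<mu> P i * sigma_pow q i (twisted_coeff q \<mu> Q j)"
proof -
  have e: "q powi (- (\<mu> * ((i + j) * (i + j - 1) div 2))) =
      q powi (- (\<mu> * (i * (i - 1) div 2))) * (q powi (- (\<mu> * (j * (j - 1) div 2))) * q powi (i * - (\<mu> * j)))"
  proof -
    have neg: "- (\<mu> * (a + b + i * j)) = - (\<mu> * a) + (- (\<mu> * b) + i * - (\<mu> * j))" for a b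
      by (simp add: algebra_simps)
    show ?thesis
      unfolding triangular_add neg using assms by (simp only: power_int_add simp_thms)
  qed
  have x: "fls_X powi (- (\<mu> * (i + j))) = fls_X powi (- (\<mu> * i)) * (fls_X powi (- (\<mu> * j)) :: complex fls)"
    by (simp add: algebra_simps flip: power_int_add del: fls_X_power_int)
  show ?thesis
    unfolding twisted_coeff_def sigma_pow_mult[OF assms] sigma_pow_const[OF assms]
      sigma_pow_X_power_int[OF assms] e x lookup_single_eq
    by (simp only: fls_const_mult_const[symmetric] mult_ac)
qed

section \<open>Initial forms\<close>

text \<open>With \<open>\<tau> = z\<^sup>\<mu> \<sigma>\<^sub>q\<close>, so that \<open>P = \<Sum> a'\<^sub>i \<tau>\<^sup>i\<close>: all \<open>a'\<^sub>i\<close> have valuation at least \<open>l\<close>, and \<open>f\<close>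
  collects the coefficients of \<open>z\<^sup>l\<close>. Here \<open>f = 0\<close> is allowed, which makes the notion additive.\<close>

definition initial_form :: "complex \<Rightarrow> int \<Rightarrow> int \<Rightarrow> qop \<Rightarrow> lpoly \<Rightarrow> bool" where
  "initial_form q \<mu> l P f \<longleftrightarrow>
     (\<forall>i. (\<forall>n<l. fls_nth (twisted_coeff q \<mu> P i) n = 0) \<and>
       fls_nth (twisted_coeff q \<mu> P i) l = Poly_Mapping.lookup f i)"

lemma char_lpoly_nth:
  "Poly_Mapping.lookup (char_lpoly q \<mu> P) i = fls_nth (twisted_coeff q \<mu> P i) (twisted_val q \<mu> P)"
proof -
  define t where "t = (\<lambda>i. fls_nth (twisted_coeff q \<mu> P i) (twisted_val q \<mu> P))"
  have "Poly_Mapping.lookup (char_lpoly q \<mu> P) i =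
      (\<Sum>j\<in>Poly_Mapping.keys P. if j = i then t j else 0)"
    unfolding char_lpoly_def lookup_sum
    by (intro sum.cong refl)
      (auto simp: lookup_single when_def t_def mult.commute[of "fls_X powi _"]
        fls_nth_mult_X_power_int simp del: fls_X_power_int)
  also have "\<dots> = (if i \<in> Poly_Mapping.keys P then t i else 0)"
    by (simp add: sum.delta)
  also have "\<dots> = t i"
    by (auto simp: t_def in_keys_iff twisted_coeff_def)
  finally show ?thesis by (simp add: t_def)
qed

lemma initial_form_char_lpoly: "initial_form q \<mu> (twisted_val q \<mu> P) P (char_lpoly q \<mu> P)"
  unfolding initial_form_def char_lpoly_nth
proof (intro allI impI conjI refl)
  fix i n assume n: "n < twisted_val q \<mu> P"
  show "fls_nth (twisted_coeff q \<mu> P i) n = 0"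
  proof (cases "i \<in> Poly_Mapping.keys P")
    case True
    then have "twisted_val q \<mu> P \<le> fls_subdegree (twisted_coeff q \<mu> P i)"
      unfolding twisted_val_def by (intro Min_le) auto
    with n show ?thesis by (intro fls_eq0_below_subdegree) auto
  next
    case False
    then show ?thesis by (simp add: in_keys_iff twisted_coeff_def)
  qed
qed

text \<open>The minimal valuation is attained at some index of the support, and there the leading
  coefficient survives.\<close>

lemma char_lpoly_nonzero:
  assumes "q \<noteq> 0" "P \<noteq> 0"
  shows "char_lpoly q \<mu> P \<noteq> 0"
proof -
  let ?v = "\<lambda>i. fls_subdegree (twisted_coeff q \<mu> P i)"
  have "Min (?v ` Poly_Mapping.keys P) \<in> ?v ` Poly_Mapping.keys P"
    using assms by (intro Min_in) auto
  then obtain i where i: "i \<in> Poly_Mapping.keys P" "twisted_val q \<mu> P = ?v i"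
    unfolding twisted_val_def by auto
  then have "twisted_coeff q \<mu> P i \<noteq> 0"
    using assms by (simp add: twisted_coeff_eq_0_iff in_keys_iff)
  then have "Poly_Mapping.lookup (char_lpoly q \<mu> P) i \<noteq> 0"
    by (simp add: char_lpoly_nth i nth_fls_subdegree_nonzero)
  then show ?thesis by auto
qed

text \<open>A non-zero \<open>f\<close> shows that the bound \<open>l\<close> is attained, so it is
  the minimal valuation. Characteristic polynomials of products are computed through this
  lemma.\<close>

lemma initial_form_unique:
  assumes q: "q \<noteq> 0" and P: "initial_form q \<mu> l P f" and f: "f \<noteq> 0"
  shows "twisted_val q \<mu> P = l" "char_lpoly q \<mu> P = f"
proof -
  obtain i where i: "Poly_Mapping.lookup f i \<noteq> 0" using f by (metis poly_mapping_eqI lookup_zero)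
  have l: "fls_nth (twisted_coeff q \<mu> P i) l \<noteq> 0" using i P by (simp add: initial_form_def)
  then have P0: "P \<noteq> 0" by (auto simp: twisted_coeff_def)
  then obtain j where j: "Poly_Mapping.lookup (char_lpoly q \<mu> P) j \<noteq> 0"
    using char_lpoly_nonzero[OF q, of P \<mu>] by (metis poly_mapping_eqI lookup_zero)
  have "\<not> l < twisted_val q \<mu> P"
    using l initial_form_char_lpoly[of q \<mu> P] unfolding initial_form_def by blast
  moreover have "\<not> twisted_val q \<mu> P < l"
    using j P unfolding initial_form_def char_lpoly_nth by blast
  ultimately show l: "twisted_val q \<mu> P = l" by simp
  show "char_lpoly q \<mu> P = f"
    using P by (intro poly_mapping_eqI) (simp add: char_lpoly_nth l initial_form_def)
qed

lemma initial_form_sum: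
  assumes "\<And>x. x \<in> A \<Longrightarrow> initial_form q \<mu> l (P x) (f x)"
  shows "initial_form q \<mu> l (\<Sum>x\<in>A. P x) (\<Sum>x\<in>A. f x)"
  using assms by (auto simp: initial_form_def twisted_coeff_sum lookup_sum fls_nth_sum)

lemma poly_mapping_sum_single_superset:
  assumes "finite A" "Poly_Mapping.keys f \<subseteq> A"
  shows "(\<Sum>i\<in>A. Poly_Mapping.single i (Poly_Mapping.lookup f i)) = f"
  by (rule poly_mapping_eqI)
    (use assms in \<open>auto simp: lookup_sum lookup_single when_def sum.delta in_keys_iff\<close>)

text \<open>Factoring out z^a and z^b reduces the claim to constant terms of power series. The
  numbers \<open>a\<close> and \<open>b\<close> are only lower bounds for the valuations, so
  vanishing coefficients there are allowed.\<close>

lemma fls_nth_mult_lowest: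
  fixes F G :: "complex fls"
  assumes "\<And>n. n < a \<Longrightarrow> fls_nth F n = 0" "\<And>n. n < b \<Longrightarrow> fls_nth G n = 0"
  shows "n < a + b \<Longrightarrow> fls_nth (F * G) n = 0" "fls_nth (F * G) (a + b) = fls_nth F a * fls_nth G b"
proof -
  define F' where "F' = fls_regpart (fls_shift a F)"
  define G' where "G' = fls_regpart (fls_shift b G)"
  have F: "F = fls_X_intpow a * fps_to_fls F'"
    using assms by (intro fls_eqI) (auto simp: F'_def fls_X_intpow_times_conv_shift(1))
  have G: "G = fls_X_intpow b * fps_to_fls G'"
    using assms by (intro fls_eqI) (auto simp: G'_def fls_X_intpow_times_conv_shift(1))
  have "F * G = (fls_X_intpow a * fls_X_intpow b) * (fps_to_fls F' * fps_to_fls G')"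
    by (simp only: F G mult_ac)
  also have "\<dots> = fls_X_intpow (a + b) * fps_to_fls (F' * G')"
    by (simp only: fls_times_fps_to_fls fls_X_intpow_times_fls_X_intpow)
  finally have FG: "F * G = fls_shift (- (a + b)) (fps_to_fls (F' * G'))"
    by (simp only: fls_X_intpow_times_conv_shift(1))
  show "n < a + b \<Longrightarrow> fls_nth (F * G) n = 0" by (simp add: FG)
  show "fls_nth (F * G) (a + b) = fls_nth F a * fls_nth G b"
    by (simp add: FG F'_def G'_def)
qed

text \<open>In general \<sigma>^i multiplies the coefficient of z^n by q^(i n). At level 0 of the
  right factor this is 1, so initial forms multiply in the commutative ring although the operators
  do not commute.\<close>

lemma initial_form_qop_mult:
  assumes q: "q \<noteq> 0" and P: "initial_form q \<mu> l P f" and Q: "initial_form q \<mu> 0 Q g"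
  shows "initial_form q \<mu> l (qop_mult q P Q) (f * g)"
proof -
  \<comment> \<open>Common index sets for operators and initial forms let the two double sums be
    compared term by term.\<close>
  let ?A = "Poly_Mapping.keys P \<union> Poly_Mapping.keys f"
  let ?B = "Poly_Mapping.keys Q \<union> Poly_Mapping.keys g"
  have "f * g = (\<Sum>i\<in>?A. Poly_Mapping.single i (Poly_Mapping.lookup f i)) *
      (\<Sum>j\<in>?B. Poly_Mapping.single j (Poly_Mapping.lookup g j))"
    by (simp add: poly_mapping_sum_single_superset)
  also have "\<dots> = (\<Sum>i\<in>?A. \<Sum>j\<in>?B. Poly_Mapping.single (i + j)
      (Poly_Mapping.lookup f i * Poly_Mapping.lookup g j))"
    by (simp only: sum_product mult_single)
  finally have fg: "f * g = \<dots>" .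
  have PQ: "qop_mult q P Q = (\<Sum>i\<in>?A. \<Sum>j\<in>?B. Poly_Mapping.single (i + j)
           (Poly_Mapping.lookup P i * sigma_pow q i (Poly_Mapping.lookup Q j)))"
    by (rule qop_mult_superset) auto
  show ?thesis
    unfolding fg PQ
  proof (intro initial_form_sum)
    fix i j
    let ?S = "Poly_Mapping.single (i + j)
      (Poly_Mapping.lookup P i * sigma_pow q i (Poly_Mapping.lookup Q j))"
    let ?a = "twisted_coeff q \<mu> P i" and ?b = "sigma_pow q i (twisted_coeff q \<mu> Q j)"
    have a: "\<And>n. n < l \<Longrightarrow> fls_nth ?a n = 0" "fls_nth ?a l = Poly_Mapping.lookup f i"
      using P by (auto simp: initial_form_def)
    have b: "\<And>n. n < 0 \<Longrightarrow> fls_nth ?b n = 0" "fls_nth ?b 0 = Poly_Mapping.lookup g j"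
      using Q by (auto simp: initial_form_def sigma_pow_nth q)
    note low = fls_nth_mult_lowest[of l ?a 0 ?b, OF a(1) b(1)]
    have "fls_nth (?a * ?b) n = 0" if "n < l" for n
      using low(1)[of n] that by simp
    moreover have "fls_nth (?a * ?b) l = Poly_Mapping.lookup f i * Poly_Mapping.lookup g j"
      using low(2) a(2) b(2) by simp
    moreover have "twisted_coeff q \<mu> ?S k = (if k = i + j then ?a * ?b else 0)" for k
      by (simp only: twisted_coeff_single[of q \<mu> "i + j" _ k] twisted_coeff_single_mult[OF q])
    ultimately show "initial_form q \<mu> l ?S
        (Poly_Mapping.single (i + j) (Poly_Mapping.lookup f i * Poly_Mapping.lookup g j))"
      by (auto simp: initial_form_def lookup_single)
  qed
qed

section \<open>Linear factors\<close>

abbreviation linear_factor :: "complex \<Rightarrow> int \<Rightarrow> complex \<Rightarrow> complex fps \<Rightarrow> qop" where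
  "linear_factor q \<mu> c u \<equiv> qop_mult q (qop_linear \<mu> c) (qop_const (inverse (fps_to_fls u)))"

lemma initial_form_qop_linear: "initial_form q \<mu> 0 (qop_linear \<mu> c) (lpoly_X - lpoly_const c)"
  by (auto simp: initial_form_def twisted_coeff_nth qop_linear_def qop_const_def lpoly_X_def
      lpoly_const_def lookup_minus lookup_single when_def)

lemma initial_form_qop_const:
  "initial_form q \<mu> 0 (qop_const (fps_to_fls v)) (lpoly_const (fps_nth v 0))"
  by (auto simp: initial_form_def twisted_coeff_nth qop_const_def lpoly_const_def lookup_single when_def)

text \<open>As \<open>u\<close> has constant term 1, so has the power series
  \<open>inverse u\<close>; its initial form is 1 and leaves that of \<tau> - c unchanged.\<close>

lemma initial_form_linear_factor:
  assumes "q \<noteq> 0" "fps_nth u 0 = 1"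
  shows "initial_form q \<mu> 0 (linear_factor q \<mu> c u) (lpoly_X - lpoly_const c)"
proof -
  have "inverse (fps_to_fls u) = fps_to_fls (inverse u)"
    using assms by (simp add: fls_inverse_fps_to_fls subdegree_eq_0)
  moreover have "lpoly_const 1 = 1" by (simp add: lpoly_const_def)
  ultimately show ?thesis
    using initial_form_qop_mult[OF assms(1) initial_form_qop_linear initial_form_qop_const,
        of \<mu> c "inverse u"] assms(2)
    by simp
qed

section \<open>Evaluation of Laurent polynomials\<close>

definition lpoly_eval :: "lpoly \<Rightarrow> complex \<Rightarrow> complex" where
  "lpoly_eval f c = (\<Sum>i\<in>Poly_Mapping.keys f. Poly_Mapping.lookup f i * c powi i)"

lemma lpoly_eval_superset:
  assumes "finite A" "Poly_Mapping.keys f \<subseteq> A"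
  shows "lpoly_eval f c = (\<Sum>i\<in>A. Poly_Mapping.lookup f i * c powi i)"
  unfolding lpoly_eval_def using assms by (intro sum.mono_neutral_left) (auto simp: in_keys_iff)

text \<open>This fails at \<open>c = 0\<close>: there s and its inverse both evaluate to 0, while
  their product evaluates to 1.\<close>

lemma lpoly_eval_mult:
  assumes "c \<noteq> 0"
  shows "lpoly_eval (f * g) c = lpoly_eval f c * lpoly_eval g c"
proof -
  let ?A = "Poly_Mapping.keys f" and ?B = "Poly_Mapping.keys g"
  let ?C = "(\<lambda>(i, j). i + j) ` (?A \<times> ?B)"
  have "f * g = (\<Sum>i\<in>?A. Poly_Mapping.single i (Poly_Mapping.lookup f i)) *
      (\<Sum>j\<in>?B. Poly_Mapping.single j (Poly_Mapping.lookup g j))"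
    by (simp add: poly_mapping_sum_single_superset)
  also have "\<dots> = (\<Sum>i\<in>?A. \<Sum>j\<in>?B. Poly_Mapping.single (i + j)
      (Poly_Mapping.lookup f i * Poly_Mapping.lookup g j))"
    by (simp only: sum_product mult_single)
  finally have fg: "f * g = \<dots>" .
  have "Poly_Mapping.keys (f * g) \<subseteq> ?C"
    using keys_mult[of f g] by auto
  then have "lpoly_eval (f * g) c = (\<Sum>k\<in>?C. Poly_Mapping.lookup (f * g) k * c powi k)"
    by (intro lpoly_eval_superset) auto
  also have "\<dots> = (\<Sum>k\<in>?C. \<Sum>i\<in>?A. \<Sum>j\<in>?B. if k = i + j then
      Poly_Mapping.lookup f i * Poly_Mapping.lookup g j * c powi k else 0)"
    unfolding fg lookup_sum sum_distrib_right
    by (intro sum.cong refl) (auto simp: lookup_single when_def)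
  also have "\<dots> = (\<Sum>i\<in>?A. \<Sum>j\<in>?B. \<Sum>k\<in>?C. if k = i + j then
      Poly_Mapping.lookup f i * Poly_Mapping.lookup g j * c powi k else 0)"
    by (subst sum.swap, rule sum.cong[OF refl], rule sum.swap)
  also have "\<dots> = (\<Sum>i\<in>?A. \<Sum>j\<in>?B. Poly_Mapping.lookup f i * c powi i *
      (Poly_Mapping.lookup g j * c powi j))"
  proof (intro sum.cong refl)
    fix i j assume "i \<in> ?A" "j \<in> ?B"
    then have "i + j \<in> ?C" by force
    then show "(\<Sum>k\<in>?C. if k = i + j then
        Poly_Mapping.lookup f i * Poly_Mapping.lookup g j * c powi k else 0) =
        Poly_Mapping.lookup f i * c powi i * (Poly_Mapping.lookup g j * c powi j)"
      using assms by (simp add: sum.delta' power_int_add)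
  qed
  also have "\<dots> = lpoly_eval f c * lpoly_eval g c"
    by (simp add: lpoly_eval_def sum_product)
  finally show ?thesis .
qed

lemma lpoly_eval_1 [simp]: "lpoly_eval 1 c = 1"
  by (simp add: lpoly_eval_def flip: single_one)

lemma lpoly_eval_single: "lpoly_eval (Poly_Mapping.single k a) x = a * x powi k"
  by (simp add: lpoly_eval_superset[of "{k}"])

lemma lpoly_eval_linear: "lpoly_eval (lpoly_X - lpoly_const a) c = c - a"
proof -
  have "Poly_Mapping.keys (lpoly_X - lpoly_const a) \<subseteq> {0, 1}"
    by (auto simp: in_keys_iff lpoly_X_def lpoly_const_def lookup_minus lookup_single when_def
        split: if_splits)
  then have "lpoly_eval (lpoly_X - lpoly_const a) c =
      (\<Sum>i\<in>{0, 1}. Poly_Mapping.lookup (lpoly_X - lpoly_const a) i * c powi i)"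
    by (intro lpoly_eval_superset) auto
  then show ?thesis
    by (simp add: lpoly_X_def lpoly_const_def lookup_minus lookup_single)
qed

lemma lpoly_eval_power: "c \<noteq> 0 \<Longrightarrow> lpoly_eval (f ^ n) c = lpoly_eval f c ^ n"
  by (induction n) (simp_all add: lpoly_eval_mult)

lemma lpoly_eval_prod: "c \<noteq> 0 \<Longrightarrow> lpoly_eval (\<Prod>x\<in>A. f x) c = (\<Prod>x\<in>A. lpoly_eval (f x) c)"
  by (induction A rule: infinite_finite_induct) (simp_all add: lpoly_eval_mult)

section \<open>Right division by a linear factor\<close>

text \<open>The closed form of the power \<tau>^i of \<tau> = z^\<mu> \<sigma> in the twisted ring,
  for negative \<open>i\<close> as well.\<close>

definition tau_pow :: "complex \<Rightarrow> int \<Rightarrow> int \<Rightarrow> qop" where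
  "tau_pow q \<mu> i =
     Poly_Mapping.single i (fls_const (q powi (\<mu> * (i * (i - 1) div 2))) * fls_X powi (\<mu> * i))"

lemma qop_const_mult_tau_pow:
  assumes "q \<noteq> 0"
  shows "qop_mult q (qop_const (twisted_coeff q \<mu> P i)) (tau_pow q \<mu> i) =
           Poly_Mapping.single i (Poly_Mapping.lookup P i)"
proof -
  let ?t = "\<mu> * (i * (i - 1) div 2)" and ?a = "Poly_Mapping.lookup P i"
  have "twisted_coeff q \<mu> P i * (fls_const (q powi ?t) * fls_X powi (\<mu> * i)) =
      ?a * (fls_const (q powi (- ?t)) * fls_const (q powi ?t)) *
        (fls_X powi (- (\<mu> * i)) * fls_X powi (\<mu> * i))"
    by (simp only: twisted_coeff_def mult_ac)
  also have "\<dots> = ?a"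
    using assms by (simp add: power_int_minus del: fls_X_power_int)
  finally show ?thesis
    using assms by (simp add: qop_const_def tau_pow_def qop_mult_single sigma_pow_zero
        del: fls_X_power_int)
qed

lemma tau_pow_mult_const:
  assumes "q \<noteq> 0"
  shows "qop_mult q (tau_pow q \<mu> i) (qop_const u) = qop_mult q (qop_const (sigma_pow q i u)) (tau_pow q \<mu> i)"
  using assms by (simp add: tau_pow_def qop_const_def qop_mult_single sigma_pow_zero mult.commute)

lemma tau_pow_mult:
  assumes "q \<noteq> 0"
  shows "qop_mult q (tau_pow q \<mu> i) (tau_pow q \<mu> j) = tau_pow q \<mu> (i + j)"
proof -
  have e: "q powi (\<mu> * ((i + j) * (i + j - 1) div 2)) =
      q powi (\<mu> * (i * (i - 1) div 2)) * (q powi (\<mu> * (j * (j - 1) div 2)) * q powi (i * (\<mu> * j)))"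
    using assms unfolding triangular_add
    by (simp add: distrib_left mult.left_commute add_ac flip: power_int_add)
  have x: "fls_X powi (\<mu> * (i + j)) = fls_X powi (\<mu> * i) * (fls_X powi (\<mu> * j) :: complex fls)"
    by (simp add: algebra_simps flip: power_int_add del: fls_X_power_int)
  show ?thesis
    unfolding tau_pow_def qop_mult_single sigma_pow_mult[OF assms] sigma_pow_const[OF assms]
      sigma_pow_X_power_int[OF assms] e x
    by (simp only: fls_const_mult_const[symmetric] mult_ac)
qed

lemma qop_linear_tau_pow: "qop_linear \<mu> c = tau_pow q \<mu> 1 - qop_const (fls_const c)"
  by (simp add: qop_linear_def tau_pow_def)

section \<open>Additivity of the twisted product\<close>

lemma qop_mult_uminus_left: "qop_mult q (- P) Q = - qop_mult q P Q"
  using qop_mult_add_left[of q P "- P" Q] by (simp add: eq_neg_iff_add_eq_0 add.commute)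

lemma qop_mult_diff_left: "qop_mult q (P - P') Q = qop_mult q P Q - qop_mult q P' Q"
  using qop_mult_add_left[of q P "- P'" Q] by (simp add: qop_mult_uminus_left)

lemma qop_mult_diff_right:
  "q \<noteq> 0 \<Longrightarrow> qop_mult q P (Q - Q') = qop_mult q P Q - qop_mult q P Q'"
  using qop_mult_add_right[of q P "Q - Q'" Q'] by (simp add: algebra_simps)

lemma qop_mult_sum_left: "qop_mult q (\<Sum>x\<in>A. f x) Q = (\<Sum>x\<in>A. qop_mult q (f x) Q)"
  by (induction A rule: infinite_finite_induct) (simp_all add: qop_mult_add_left)

lemma qop_const_mult: "q \<noteq> 0 \<Longrightarrow> qop_mult q (qop_const a) (qop_const b) = qop_const (a * b)"
  by (simp add: qop_const_def qop_mult_single sigma_pow_zero)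

lemma fps_to_fls_sum: "fps_to_fls (\<Sum>x\<in>A. f x) = (\<Sum>x\<in>A. fps_to_fls (f x))"
  by (induction A rule: infinite_finite_induct) simp_all

lemma qop_const_sum: "qop_const (\<Sum>x\<in>A. f x) = (\<Sum>x\<in>A. qop_const (f x))"
  by (induction A rule: infinite_finite_induct) (simp_all add: qop_const_def single_add)

lemma qop_const_one_mult: "q \<noteq> 0 \<Longrightarrow> qop_mult q (qop_const 1) P = P" "q \<noteq> 0 \<Longrightarrow> qop_mult q P (qop_const 1) = P"
  by (simp_all add: qop_const_def qop_mult_one del: single_one)

text \<open>Constants commute with \<tau>, so the commutative recurrences apply. Upwards:
  \<tau>^(i+1) - c^(i+1) = \<tau>^i (\<tau> - c) + c (\<tau>^i - c^i). Downwards: \<tau>^(i-1) -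
  c^(i-1) = c^(-1) ((\<tau>^i - c^i) - \<tau>^(i-1) (\<tau> - c)).\<close>

lemma tau_pow_minus_const:
  assumes q: "q \<noteq> 0" and c: "c \<noteq> 0"
  shows "\<exists>S. tau_pow q \<mu> i - qop_const (fls_const (c powi i)) = qop_mult q S (qop_linear \<mu> c)"
proof (induction i rule: int_induct[where k = 0])
  case base
  then show ?case
    by (intro exI[of _ 0]) (simp add: tau_pow_def qop_const_def)
next
  case (step1 i)
  then obtain S where S: "tau_pow q \<mu> i - qop_const (fls_const (c powi i)) = qop_mult q S (qop_linear \<mu> c)"
    by blast
  let ?C = "qop_const (fls_const c)"
  have "qop_mult q (tau_pow q \<mu> i + qop_mult q ?C S) (qop_linear \<mu> c) =
      qop_mult q (tau_pow q \<mu> i) (qop_linear \<mu> c) +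
      qop_mult q ?C (tau_pow q \<mu> i - qop_const (fls_const (c powi i)))"
    by (simp add: qop_mult_add_left qop_mult_assoc q S)
  also have "\<dots> = tau_pow q \<mu> (i + 1) - qop_const (fls_const (c * c powi i))"
    by (simp add: qop_linear_tau_pow[of _ _ q] qop_mult_diff_right tau_pow_mult tau_pow_mult_const
        qop_const_mult q)
  also have "c * c powi i = c powi (i + 1)" using c by (simp add: power_int_add_1')
  finally show ?case by metis
next
  case (step2 i)
  then obtain S where S: "tau_pow q \<mu> i - qop_const (fls_const (c powi i)) = qop_mult q S (qop_linear \<mu> c)"
    by blast
  let ?C = "qop_const (fls_const (inverse c))"
  have "qop_mult q (qop_mult q ?C (S - tau_pow q \<mu> (i - 1))) (qop_linear \<mu> c) =
      qop_mult q ?C (tau_pow q \<mu> i - qop_const (fls_const (c powi i)) -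
        qop_mult q (tau_pow q \<mu> (i - 1)) (qop_linear \<mu> c))"
    by (simp add: qop_mult_diff_left qop_mult_diff_right qop_mult_assoc q S)
  also have "\<dots> = qop_mult q ?C (qop_mult q (qop_const (fls_const c)) (tau_pow q \<mu> (i - 1))
      - qop_const (fls_const (c powi i)))"
    by (simp add: qop_linear_tau_pow[of _ _ q] qop_mult_diff_right tau_pow_mult tau_pow_mult_const q)
  also have "\<dots> = tau_pow q \<mu> (i - 1) - qop_const (fls_const (inverse c * c powi i))"
    using c by (simp add: qop_mult_diff_right qop_const_mult q qop_const_one_mult
        flip: qop_mult_assoc)
  also have "inverse c * c powi i = c powi (i - 1)"
    using c by (simp add: power_int_diff field_simps)
  finally show ?case by metis
qed

lemma qop_expansion:
  assumes "q \<noteq> 0"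
  shows "P = (\<Sum>i\<in>Poly_Mapping.keys P. qop_mult q (qop_const (twisted_coeff q \<mu> P i)) (tau_pow q \<mu> i))"
  by (simp add: qop_const_mult_tau_pow[OF assms] poly_mapping_sum_single)

text \<open>Moving \<open>u\<close> to the left of each \<tau>^i and replacing \<tau>^i by c^i
  changes P u by a left multiple of \<tau> - c. What remains has degree 0 and is the sum assumed to
  vanish.\<close>

lemma right_division:
  assumes q: "q \<noteq> 0" and c: "c \<noteq> 0"
    and eq: "(\<Sum>i\<in>Poly_Mapping.keys P.
      twisted_coeff q \<mu> P i * sigma_pow q i u * fls_const (c powi i)) = 0"
  shows "\<exists>Q. qop_mult q P (qop_const u) = qop_mult q Q (qop_linear \<mu> c)"
proof -
  let ?b = "\<lambda>i. twisted_coeff q \<mu> P i * sigma_pow q i u"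
  obtain S where S: "\<And>i. tau_pow q \<mu> i - qop_const (fls_const (c powi i)) = qop_mult q (S i) (qop_linear \<mu> c)"
    using tau_pow_minus_const[OF q c] by metis
  have "qop_mult q P (qop_const u) =
      (\<Sum>i\<in>Poly_Mapping.keys P. qop_mult q (qop_const (?b i)) (tau_pow q \<mu> i))"
    by (subst qop_expansion[OF q, of P \<mu>], unfold qop_mult_sum_left qop_mult_assoc[OF q]
      tau_pow_mult_const[OF q]) (simp add: qop_const_mult q flip: qop_mult_assoc)
  also have "\<dots> = (\<Sum>i\<in>Poly_Mapping.keys P. qop_mult q (qop_const (?b i))
      (qop_mult q (S i) (qop_linear \<mu> c) + qop_const (fls_const (c powi i))))"
    by (simp add: S[symmetric])
  also have "\<dots> = qop_mult q (\<Sum>i\<in>Poly_Mapping.keys P. qop_mult q (qop_const (?b i)) (S i)) (qop_linear \<mu> c)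
      + qop_const (\<Sum>i\<in>Poly_Mapping.keys P. ?b i * fls_const (c powi i))"
    by (simp add: qop_mult_sum_left qop_mult_add_right q qop_mult_assoc qop_const_mult qop_const_sum
        sum.distrib)
  also have "\<dots> = qop_mult q (\<Sum>i\<in>Poly_Mapping.keys P. qop_mult q (qop_const (?b i)) (S i)) (qop_linear \<mu> c)"
    by (simp add: eq qop_const_def)
  finally show ?thesis by blast
qed

section \<open>Solving the resulting \<open>q\<close>-difference equation\<close>

text \<open>Forward substitution: \<open>B m k\<close> is the factor of the unknown number
  \<open>k\<close> in equation number \<open>m + k\<close>, so the diagonal entries are
  \<open>B 0 n\<close>.\<close>

fun triangular_solution :: "(nat \<Rightarrow> nat \<Rightarrow> complex) \<Rightarrow> nat \<Rightarrow> complex" where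
  "triangular_solution B n =
     (if n = 0 then 1 else - (\<Sum>k<n. B (n - k) k * triangular_solution B k) / B 0 n)"

declare triangular_solution.simps [simp del]

lemma triangular_solution:
  assumes "B 0 0 = 0" "\<And>n. n > 0 \<Longrightarrow> B 0 n \<noteq> 0"
  shows "(\<Sum>k\<le>n. B (n - k) k * triangular_solution B k) = 0"
proof (cases "n = 0")
  case False
  have "(\<Sum>k\<le>n. B (n - k) k * triangular_solution B k) =
      (\<Sum>k<n. B (n - k) k * triangular_solution B k) + B 0 n * triangular_solution B n"
    by (simp add: lessThan_Suc_atMost[symmetric])
  also have "\<dots> = 0"
    using assms(2)[of n] False by (subst (2) triangular_solution.simps) simp
  finally show ?thesis .
qed (use assms in simp)

text \<open>Since \<sigma>^i multiplies the \<open>k\<close>-th coefficient of \<open>u\<close> by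
  q^(i k), comparing coefficients of z^(l+n) gives a triangular system. The entry at
  \<open>k = n\<close> involves only the lowest coefficients of the a'_i and is the characteristic
  polynomial at \<open>c * q ^ n\<close>.\<close>

lemma q_difference_solution:
  assumes q: "q \<noteq> 0" and c: "c \<noteq> 0"
    and root: "lpoly_eval (char_lpoly q \<mu> P) c = 0"
    and nonroot: "\<And>n::nat. n > 0 \<Longrightarrow> lpoly_eval (char_lpoly q \<mu> P) (c * q ^ n) \<noteq> 0"
  shows "\<exists>u. fps_nth u 0 = 1 \<and> (\<Sum>i\<in>Poly_Mapping.keys P.
      twisted_coeff q \<mu> P i * sigma_pow q i (fps_to_fls u) * fls_const (c powi i)) = 0"
proof -
  define l where "l = twisted_val q \<mu> P"
  \<comment> \<open>The power series z^(-l) a'_i; taking the regular part loses nothing because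
    \<open>l\<close> is the minimal valuation.\<close>
  define A where "A = (\<lambda>i. fls_regpart (fls_shift l (twisted_coeff q \<mu> P i)))"
  have low: "\<And>i n. n < l \<Longrightarrow> fls_nth (twisted_coeff q \<mu> P i) n = 0"
    using initial_form_char_lpoly[of q \<mu> P] by (auto simp: initial_form_def l_def)
  have A: "twisted_coeff q \<mu> P i = fls_X_intpow l * fps_to_fls (A i)" for i
    using low by (intro fls_eqI) (auto simp: A_def fls_X_intpow_times_conv_shift(1))
  \<comment> \<open>Here \<open>c * q ^ k\<close> combines the factor c^i of the equation with the
    factor q^(i k) from \<sigma>^i.\<close>
  define B where "B = (\<lambda>m k. \<Sum>i\<in>Poly_Mapping.keys P. fps_nth (A i) m * (c * q ^ k) powi i)"
  have B0: "B 0 k = lpoly_eval (char_lpoly q \<mu> P) (c * q ^ k)" for k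
  proof -
    have "Poly_Mapping.keys (char_lpoly q \<mu> P) \<subseteq> Poly_Mapping.keys P"
      by (auto simp: in_keys_iff char_lpoly_nth twisted_coeff_def)
    then show ?thesis
      by (simp add: B_def lpoly_eval_superset[of "Poly_Mapping.keys P"] A_def char_lpoly_nth l_def)
  qed
  define u where "u = Abs_fps (triangular_solution B)"
  define U where "U = (\<lambda>i. Abs_fps (\<lambda>n. (q powi i) ^ n * fps_nth u n))"
  have U: "sigma_pow q i (fps_to_fls u) = fps_to_fls (U i)" for i
    by (rule fls_eqI) (auto simp: sigma_pow_nth q U_def power_int_def)
  have "(\<Sum>i\<in>Poly_Mapping.keys P. A i * U i * fps_const (c powi i)) = 0"
  proof (rule fps_ext)
    fix n
    have "fps_nth (\<Sum>i\<in>Poly_Mapping.keys P. A i * U i * fps_const (c powi i)) n =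
        (\<Sum>i\<in>Poly_Mapping.keys P. \<Sum>k\<le>n. fps_nth (A i) (n - k) * (c * q ^ k) powi i * fps_nth u k)"
    proof (unfold fps_sum_nth, intro sum.cong refl)
      fix i
      have "fps_nth (A i * U i * fps_const (c powi i)) n =
          (\<Sum>k\<le>n. fps_nth (U i) k * fps_nth (A i) (n - k)) * c powi i"
        by (subst mult.commute[of "A i"])
          (subst fps_mult_right_const_nth, simp only: fps_mult_nth atMost_atLeast0)
      also have "\<dots> = (\<Sum>k\<le>n. fps_nth (A i) (n - k) * (c * q ^ k) powi i * fps_nth u k)"
        unfolding sum_distrib_right
      proof (intro sum.cong refl)
        fix k
        have "(q powi i) ^ k = (q ^ k) powi i"
          by (metis power_int_mult power_int_of_nat mult.commute)
        then show "fps_nth (U i) k * fps_nth (A i) (n - k) * c powi i =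
            fps_nth (A i) (n - k) * (c * q ^ k) powi i * fps_nth u k"
          by (simp add: U_def power_int_mult_distrib)
      qed
      finally show "fps_nth (A i * U i * fps_const (c powi i)) n = \<dots>" .
    qed
    also have "\<dots> = (\<Sum>k\<le>n. B (n - k) k * triangular_solution B k)"
      by (subst sum.swap) (simp add: B_def u_def sum_distrib_right)
    also have "\<dots> = 0"
      by (rule triangular_solution) (use root nonroot in \<open>auto simp: B0\<close>)
    finally show "fps_nth (\<Sum>i\<in>Poly_Mapping.keys P. A i * U i * fps_const (c powi i)) n = fps_nth 0 n"
      by simp
  qed
  then have "fls_X_intpow l * fps_to_fls (\<Sum>i\<in>Poly_Mapping.keys P. A i * U i * fps_const (c powi i)) = 0"
    by simp
  then have "(\<Sum>i\<in>Poly_Mapping.keys P.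
      twisted_coeff q \<mu> P i * sigma_pow q i (fps_to_fls u) * fls_const (c powi i)) = 0"
    by (simp add: A U fps_to_fls_sum sum_distrib_left mult.assoc fls_times_fps_to_fls)
  moreover have "fps_nth u 0 = 1" by (simp add: u_def triangular_solution.simps)
  ultimately show ?thesis by blast
qed

text \<open>The characteristic polynomial of the quotient is not computed from its coefficients:
  multiplied by X - c it gives that of \<open>P\<close>, and X - c cancels because Laurent
  polynomials form an integral domain.\<close>

lemma split_linear_factor:
  assumes q: "q \<noteq> 0" and c: "c \<noteq> 0" and P: "P \<noteq> 0"
    and char: "char_lpoly q \<mu> P = f * (lpoly_X - lpoly_const c)"
    and nonroot: "\<And>n::nat. n > 0 \<Longrightarrow> lpoly_eval (char_lpoly q \<mu> P) (c * q ^ n) \<noteq> 0"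
  shows "\<exists>Q u. fps_nth u 0 = 1 \<and> P = qop_mult q Q (linear_factor q \<mu> c u) \<and>
           Q \<noteq> 0 \<and> char_lpoly q \<mu> Q = f"
proof -
  have "lpoly_eval (char_lpoly q \<mu> P) c = 0"
    using c by (simp add: char lpoly_eval_mult lpoly_eval_linear)
  from q_difference_solution[OF q c this nonroot] obtain u where u: "fps_nth u 0 = 1"
    and eq: "(\<Sum>i\<in>Poly_Mapping.keys P.
      twisted_coeff q \<mu> P i * sigma_pow q i (fps_to_fls u) * fls_const (c powi i)) = 0"
    by blast
  from right_division[OF q c eq]
  obtain Q where Q: "qop_mult q P (qop_const (fps_to_fls u)) = qop_mult q Q (qop_linear \<mu> c)"
    by blast
  have "u \<noteq> 0" using u by auto
  \<comment> \<open>Inserting \<open>u\<close> times its inverse on the right of \<open>P\<close>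
    makes the division of P u available.\<close>
  then have "P = qop_mult q (qop_mult q P (qop_const (fps_to_fls u))) (qop_const (inverse (fps_to_fls u)))"
    by (simp add: qop_mult_assoc q qop_const_mult qop_const_one_mult)
  also have "\<dots> = qop_mult q Q (linear_factor q \<mu> c u)"
    by (simp add: Q qop_mult_assoc q)
  finally have PQ: "P = qop_mult q Q (linear_factor q \<mu> c u)" .
  have Q0: "Q \<noteq> 0" using P PQ by auto
  have nz: "lpoly_X - lpoly_const c \<noteq> 0"
  proof
    assume "lpoly_X - lpoly_const c = 0"
    then have "Poly_Mapping.lookup (lpoly_X - lpoly_const c) 1 = 0" by simp
    then show False by (simp add: lpoly_X_def lpoly_const_def lookup_minus lookup_single)
  qed
  have "initial_form q \<mu> (twisted_val q \<mu> Q) P (char_lpoly q \<mu> Q * (lpoly_X - lpoly_const c))"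
    unfolding PQ
    by (rule initial_form_qop_mult[OF q initial_form_char_lpoly initial_form_linear_factor[OF q u]])
  then have "char_lpoly q \<mu> P = char_lpoly q \<mu> Q * (lpoly_X - lpoly_const c)"
    using char_lpoly_nonzero[OF q Q0] nz by (intro initial_form_unique[OF q]) auto
  then have "char_lpoly q \<mu> Q = f" using char nz by simp
  with u PQ Q0 show ?thesis by blast
qed

section \<open>Splitting off all linear factors\<close>

abbreviation qop_prod :: "complex \<Rightarrow> qop list \<Rightarrow> qop" where
  "qop_prod q \<equiv> ordered_prod (skew_laurent q UNIV)"

lemma skew_laurent_mult: "mult (skew_laurent q K) = qop_mult q"
  and skew_laurent_one: "one (skew_laurent q K) = Poly_Mapping.single 0 1"
  by (simp_all add: skew_laurent_def)

lemma qop_prod_Nil [simp]: "qop_prod q [] = Poly_Mapping.single 0 1"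
  and qop_prod_Cons [simp]: "qop_prod q (x # xs) = qop_mult q x (qop_prod q xs)"
  by (simp_all add: ordered_prod_def skew_laurent_mult skew_laurent_one)

lemma qop_prod_append:
  "q \<noteq> 0 \<Longrightarrow> qop_prod q (xs @ ys) = qop_mult q (qop_prod q xs) (qop_prod q ys)"
  by (induction xs) (simp_all add: qop_mult_one qop_mult_assoc del: single_one)

abbreviation linear_factor_block :: "complex \<Rightarrow> int \<Rightarrow> complex \<Rightarrow> nat \<Rightarrow> (nat \<Rightarrow> complex fps) \<Rightarrow> qop" where
  "linear_factor_block q \<mu> c m u \<equiv>
     qop_prod q (map (\<lambda>j. linear_factor q \<mu> c (u j)) (rev [1..<Suc m]))"

lemma power_neq_1:
  fixes q :: complex
  assumes "norm q > 1" "n > 0"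
  shows "q ^ n \<noteq> 1"
proof
  assume "q ^ n = 1"
  then have "norm q ^ n = 1" by (metis norm_one norm_power)
  with one_less_power[OF assms] show False by simp
qed

text \<open>The induction hypothesis is applied with \<open>f\<close> enlarged by one factor X - c;
  this factor is then split off the quotient. The new linear factor stands leftmost and gets index
  \<open>Suc m\<close>, in accordance with the decreasing indices of the block.\<close>

lemma split_linear_factor_block:
  assumes q: "norm q > 1" and c: "c \<noteq> 0" and P: "P \<noteq> 0"
    and char: "char_lpoly q \<mu> P = f * (lpoly_X - lpoly_const c) ^ m"
    and nonroot: "\<And>n::nat. n > 0 \<Longrightarrow> lpoly_eval f (c * q ^ n) \<noteq> 0"
  shows "\<exists>Q u. (\<forall>j\<in>{1..m}. fps_nth (u j) 0 = 1) \<and>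
           P = qop_mult q Q (linear_factor_block q \<mu> c m u) \<and> Q \<noteq> 0 \<and> char_lpoly q \<mu> Q = f"
  using char nonroot
proof (induction m arbitrary: f)
  case 0
  have "q \<noteq> 0" using q by auto
  with 0 P show ?case by (auto simp: qop_mult_one simp del: single_one)
next
  case (Suc m)
  have q0: "q \<noteq> 0" using q by auto
  let ?L = "lpoly_X - lpoly_const c"
  \<comment> \<open>The additional factor vanishes only at \<open>c\<close>, and
    \<open>c * q ^ n\<close> differs from \<open>c\<close> because no positive power of
    \<open>q\<close> is 1.\<close>
  have nonroot: "lpoly_eval (f * ?L) (c * q ^ n) \<noteq> 0" if "n > 0" for n :: nat
    using that Suc.prems(2)[of n] power_neq_1[OF q, of n] c q0
    by (simp add: lpoly_eval_mult lpoly_eval_linear)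
  have "char_lpoly q \<mu> P = f * ?L * ?L ^ m" using Suc.prems(1) by (simp add: mult_ac)
  from Suc.IH[OF this nonroot] obtain Q u where u: "\<forall>j\<in>{1..m}. fps_nth (u j) 0 = 1"
    and PQ: "P = qop_mult q Q (linear_factor_block q \<mu> c m u)"
    and Q: "Q \<noteq> 0" "char_lpoly q \<mu> Q = f * ?L" by blast
  from split_linear_factor[OF q0 c Q] nonroot Q(2)
  obtain Q' v where v: "fps_nth v 0 = 1" and Q': "Q = qop_mult q Q' (linear_factor q \<mu> c v)"
      "Q' \<noteq> 0" "char_lpoly q \<mu> Q' = f" by auto
  let ?u = "u(Suc m := v)"
  have "linear_factor_block q \<mu> c (Suc m) ?u =
      qop_mult q (linear_factor q \<mu> c v) (linear_factor_block q \<mu> c m ?u)" by simp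
  also have "linear_factor_block q \<mu> c m ?u = linear_factor_block q \<mu> c m u"
    by (intro arg_cong[of _ _ "qop_prod q"] map_cong) auto
  finally have "P = qop_mult q Q' (linear_factor_block q \<mu> c (Suc m) ?u)"
    using PQ Q'(1) by (simp add: qop_mult_assoc q0)
  moreover have "\<forall>j\<in>{1..Suc m}. fps_nth (?u j) 0 = 1" using u v by auto
  ultimately show ?case using Q' by blast
qed

text \<open>The last block is the rightmost one, so it is removed from \<open>P\<close> itself and
  the induction hypothesis is applied to the quotient; hence \<open>P\<close> must be arbitrary in
  the induction.\<close>

lemma split_linear_factor_blocks:
  assumes q: "norm q > 1" and c: "\<And>i. i \<in> {1..p} \<Longrightarrow> c i \<noteq> 0" and P: "P \<noteq> 0"
    and char: "char_lpoly q \<mu> P = f * (\<Prod>i\<in>{1..p}. (lpoly_X - lpoly_const (c i)) ^ m i)"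
    and nonroot: "\<And>x. x \<noteq> 0 \<Longrightarrow> lpoly_eval f x \<noteq> 0"
    and order: "\<And>i j l. i \<in> {1..p} \<Longrightarrow> j \<in> {1..p} \<Longrightarrow> l \<ge> (1::nat) \<Longrightarrow> c j / c i = q ^ l \<Longrightarrow> i < j"
  shows "\<exists>Q u. (\<forall>i\<in>{1..p}. \<forall>j\<in>{1..m i}. fps_nth (u i j) 0 = 1) \<and>
           P = qop_mult q Q (qop_prod q (map (\<lambda>i. linear_factor_block q \<mu> (c i) (m i) (u i)) [1..<Suc p])) \<and>
           char_lpoly q \<mu> Q = f"
  using c P char order
proof (induction p arbitrary: P)
  case 0
  have "q \<noteq> 0" using q by auto
  with 0 show ?case by (auto simp: qop_mult_one simp del: single_one)
next
  case (Suc p)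
  have q0: "q \<noteq> 0" using q by auto
  let ?g = "f * (\<Prod>i\<in>{1..p}. (lpoly_X - lpoly_const (c i)) ^ m i)" and ?c = "c (Suc p)"
  have c: "?c \<noteq> 0" using Suc.prems(1) by simp
  have "lpoly_eval ?g (?c * q ^ n) \<noteq> 0" if n: "n > 0" for n :: nat
  proof -
    have "?c * q ^ n \<noteq> c i" if i: "i \<in> {1..p}" for i
    proof
      assume "?c * q ^ n = c i"
      then have "c i / ?c = q ^ n" using c by (simp add: field_simps)
      \<comment> \<open>The numbering would give \<open>Suc p < i\<close>, whereas \<open>i\<close>
        is at most \<open>p\<close>.\<close>
      from Suc.prems(4)[OF _ _ _ this] i n show False by simp
    qed
    then show ?thesis
      using c q0 nonroot
      by (simp add: lpoly_eval_mult lpoly_eval_prod lpoly_eval_power lpoly_eval_linear)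
  qed
  moreover have "char_lpoly q \<mu> P = ?g * (lpoly_X - lpoly_const ?c) ^ m (Suc p)"
    using Suc.prems(3) by (simp add: mult.assoc)
  ultimately obtain Q v where v: "\<forall>j\<in>{1..m (Suc p)}. fps_nth (v j) 0 = 1"
    and PQ: "P = qop_mult q Q (linear_factor_block q \<mu> ?c (m (Suc p)) v)"
    and Q: "Q \<noteq> 0" "char_lpoly q \<mu> Q = ?g"
    using split_linear_factor_block[OF q c Suc.prems(2)] by blast
  have "\<exists>Q' u. (\<forall>i\<in>{1..p}. \<forall>j\<in>{1..m i}. fps_nth (u i j) 0 = 1) \<and>
      Q = qop_mult q Q' (qop_prod q (map (\<lambda>i. linear_factor_block q \<mu> (c i) (m i) (u i)) [1..<Suc p])) \<and>
      char_lpoly q \<mu> Q' = f"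
    by (rule Suc.IH[OF Suc.prems(1) Q(1) Q(2) Suc.prems(4)]) auto
  then obtain Q' u where u: "\<forall>i\<in>{1..p}. \<forall>j\<in>{1..m i}. fps_nth (u i j) 0 = 1"
    and Q': "Q = qop_mult q Q' (qop_prod q (map (\<lambda>i. linear_factor_block q \<mu> (c i) (m i) (u i)) [1..<Suc p]))"
      "char_lpoly q \<mu> Q' = f"
    by blast
  let ?u = "u(Suc p := v)"
  have "map (\<lambda>i. linear_factor_block q \<mu> (c i) (m i) (u i)) [1..<Suc p] =
      map (\<lambda>i. linear_factor_block q \<mu> (c i) (m i) (?u i)) [1..<Suc p]"
    by (rule map_cong) auto
  moreover have "map (\<lambda>i. linear_factor_block q \<mu> (c i) (m i) (?u i)) [1..<Suc (Suc p)] =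
      map (\<lambda>i. linear_factor_block q \<mu> (c i) (m i) (?u i)) [1..<Suc p] @
        [linear_factor_block q \<mu> ?c (m (Suc p)) v]"
    by simp
  ultimately have "P = qop_mult q Q'
      (qop_prod q (map (\<lambda>i. linear_factor_block q \<mu> (c i) (m i) (?u i)) [1..<Suc (Suc p)]))"
    using PQ Q'(1) by (simp only: qop_prod_append[OF q0] qop_mult_assoc[OF q0] qop_prod_Cons
        qop_prod_Nil qop_mult_one[OF q0])
  moreover have "\<forall>i\<in>{1..Suc p}. \<forall>j\<in>{1..m i}. fps_nth (?u i j) 0 = 1"
    using u v by (auto simp: le_Suc_eq)
  ultimately show ?case using Q'(2) by blast
qed

section \<open>Properties of products of linear factors\<close>

lemma initial_form_qop_prod:
  assumes "q \<noteq> 0" "\<And>x. x \<in> set xs \<Longrightarrow> initial_form q \<mu> 0 (F x) (g x)"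
  shows "initial_form q \<mu> 0 (qop_prod q (map F xs)) (\<Prod>x\<leftarrow>xs. g x)"
  using assms(2)
proof (induction xs)
  case Nil
  show ?case
    by (auto simp: initial_form_def twisted_coeff_nth lookup_single when_def simp flip: single_one)
next
  case (Cons x xs)
  then show ?case by (auto intro!: initial_form_qop_mult[OF assms(1)])
qed

text \<open>Degree bounds of this kind confine the Newton polygon of the product of the linear
  factors to a vertical strip.\<close>

lemma keys_qop_mult:
  assumes P: "Poly_Mapping.keys P \<subseteq> {0..int m}" and Q: "Poly_Mapping.keys Q \<subseteq> {0..int n}"
  shows "Poly_Mapping.keys (qop_mult q P Q) \<subseteq> {0..int (m + n)}"
proof -
  have "Poly_Mapping.lookup (qop_mult q P Q) k = 0" if "k \<notin> {0..int (m + n)}" for k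
    unfolding qop_mult_def lookup_sum
  proof (intro sum.neutral ballI)
    fix i j assume "i \<in> Poly_Mapping.keys P" "j \<in> Poly_Mapping.keys Q"
    then have "i + j \<in> {0..int (m + n)}" using P Q by force
    with that show "Poly_Mapping.lookup (Poly_Mapping.single (i + j)
        (Poly_Mapping.lookup P i * sigma_pow q i (Poly_Mapping.lookup Q j))) k = 0"
      by (auto simp: lookup_single when_def)
  qed
  then show ?thesis by (force simp: in_keys_iff)
qed

lemma keys_qop_prod:
  assumes "\<And>x. x \<in> set xs \<Longrightarrow> Poly_Mapping.keys (F x) \<subseteq> {0..int (d x)}"
  shows "Poly_Mapping.keys (qop_prod q (map F xs)) \<subseteq> {0..int (\<Sum>x\<leftarrow>xs. d x)}"
  using assms
proof (induction xs)
  case (Cons x xs)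
  have "Poly_Mapping.keys (qop_mult q (F x) (qop_prod q (map F xs))) \<subseteq> {0..int (d x + (\<Sum>x\<leftarrow>xs. d x))}"
    using Cons by (intro keys_qop_mult) auto
  then show ?case by simp
qed simp

lemma keys_linear_factor: "Poly_Mapping.keys (linear_factor q \<mu> c u) \<subseteq> {0..int 1}"
proof -
  have "Poly_Mapping.keys (linear_factor q \<mu> c u) \<subseteq> {0..int (1 + 0)}"
    by (intro keys_qop_mult)
      (auto simp: in_keys_iff qop_linear_def qop_const_def lookup_minus lookup_single when_def
        split: if_splits)
  then show ?thesis by simp
qed

lemma initial_form_linear_factor_block:
  assumes "q \<noteq> 0" "\<And>j. j \<in> {1..m} \<Longrightarrow> fps_nth (u j) 0 = 1"
  shows "initial_form q \<mu> 0 (linear_factor_block q \<mu> c m u) ((lpoly_X - lpoly_const c) ^ m)"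
proof -
  have "initial_form q \<mu> 0 (linear_factor_block q \<mu> c m u)
      (\<Prod>j\<leftarrow>rev [1..<Suc m]. lpoly_X - lpoly_const c)"
    using assms by (intro initial_form_qop_prod initial_form_linear_factor) auto
  then show ?thesis by (simp add: map_replicate_const prod_list_replicate del: upt_Suc)
qed

lemma keys_linear_factor_block:
  "Poly_Mapping.keys (linear_factor_block q \<mu> c m u) \<subseteq> {0..int m}"
proof -
  have "Poly_Mapping.keys (linear_factor_block q \<mu> c m u) \<subseteq> {0..int (\<Sum>j\<leftarrow>rev [1..<Suc m]. 1)}"
    by (intro keys_qop_prod keys_linear_factor)
  then show ?thesis by (simp add: sum_list_triv del: upt_Suc)
qed

section \<open>Laurent polynomials and polynomials\<close>

lemma lookup_single_mult:
  "Poly_Mapping.lookup (Poly_Mapping.single k a * g) j = a * Poly_Mapping.lookup g (j - k)"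
  for g :: lpoly
proof -
  have "Poly_Mapping.single k a * g =
      Poly_Mapping.single k a * (\<Sum>i\<in>Poly_Mapping.keys g. Poly_Mapping.single i (Poly_Mapping.lookup g i))"
    by (simp add: poly_mapping_sum_single_superset)
  also have "\<dots> = (\<Sum>i\<in>Poly_Mapping.keys g. Poly_Mapping.single (k + i) (a * Poly_Mapping.lookup g i))"
    by (simp add: sum_distrib_left mult_single)
  also have "Poly_Mapping.lookup \<dots> j =
      (\<Sum>i\<in>Poly_Mapping.keys g. if i = j - k then a * Poly_Mapping.lookup g i else 0)"
    unfolding lookup_sum by (intro sum.cong refl) (auto simp: lookup_single when_def)
  also have "\<dots> = a * Poly_Mapping.lookup g (j - k)"
    by (auto simp: sum.delta' in_keys_iff)
  finally show ?thesis .
qed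

text \<open>The embedding of polynomials into Laurent polynomials; it carries over the factorization
  into linear factors.\<close>

definition lpoly_of_poly :: "complex poly \<Rightarrow> lpoly" where
  "lpoly_of_poly r = (\<Sum>n\<le>degree r. Poly_Mapping.single (int n) (coeff r n))"

lemma lookup_lpoly_of_poly:
  "Poly_Mapping.lookup (lpoly_of_poly r) k = (if k \<ge> 0 then coeff r (nat k) else 0)"
proof -
  have "Poly_Mapping.lookup (lpoly_of_poly r) k = (\<Sum>n\<le>degree r. if int n = k then coeff r n else 0)"
    unfolding lpoly_of_poly_def lookup_sum by (intro sum.cong refl) (auto simp: lookup_single when_def)
  also have "\<dots> = (\<Sum>n\<le>degree r. if n = nat k then (if k \<ge> 0 then coeff r n else 0) else 0)"
    by (intro sum.cong refl) auto
  also have "\<dots> = (if k \<ge> 0 then coeff r (nat k) else 0)"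
    by (auto simp: coeff_eq_0)
  finally show ?thesis .
qed

lemma lpoly_of_poly_0 [simp]: "lpoly_of_poly 0 = 0"
  by (rule poly_mapping_eqI) (simp add: lookup_lpoly_of_poly)

lemma lpoly_of_poly_1 [simp]: "lpoly_of_poly 1 = 1"
  by (simp add: lpoly_of_poly_def)

lemma lpoly_of_poly_add: "lpoly_of_poly (r + s) = lpoly_of_poly r + lpoly_of_poly s"
  by (rule poly_mapping_eqI) (simp add: lookup_lpoly_of_poly lookup_add)

lemma lpoly_of_poly_smult: "lpoly_of_poly (smult a r) = Poly_Mapping.single 0 a * lpoly_of_poly r"
  by (rule poly_mapping_eqI) (simp add: lookup_lpoly_of_poly lookup_single_mult)

lemma lpoly_of_poly_pCons:
  "lpoly_of_poly (pCons a r) = lpoly_const a + lpoly_X * lpoly_of_poly r"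
  unfolding lpoly_const_def lpoly_X_def
  by (rule poly_mapping_eqI)
    (auto simp: lookup_lpoly_of_poly lookup_single_mult lookup_add lookup_single coeff_pCons
      nat_diff_distrib split: nat.splits)

lemma lpoly_of_poly_mult: "lpoly_of_poly (r * s) = lpoly_of_poly r * lpoly_of_poly s"
proof (induction r)
  case (pCons a r)
  have "lpoly_of_poly (pCons a r * s) =
      Poly_Mapping.single 0 a * lpoly_of_poly s + lpoly_X * (lpoly_of_poly r * lpoly_of_poly s)"
    by (simp add: mult_pCons_left lpoly_of_poly_add lpoly_of_poly_smult lpoly_of_poly_pCons pCons.IH
        lpoly_const_def)
  then show ?case
    by (simp add: lpoly_of_poly_pCons lpoly_const_def algebra_simps)
qed simp

lemma lpoly_of_poly_power: "lpoly_of_poly (r ^ n) = lpoly_of_poly r ^ n"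
  by (induction n) (simp_all add: lpoly_of_poly_mult)

lemma lpoly_of_poly_prod: "lpoly_of_poly (\<Prod>x\<in>A. r x) = (\<Prod>x\<in>A. lpoly_of_poly (r x))"
  by (induction A rule: infinite_finite_induct) (simp_all add: lpoly_of_poly_mult)

lemma lpoly_of_poly_linear: "lpoly_of_poly [:- c, 1:] = lpoly_X - lpoly_const c"
  by (simp add: lpoly_of_poly_pCons lpoly_const_def single_uminus)

section \<open>Linear factors of a Laurent polynomial\<close>

lemma coeff_lpoly_to_poly:
  "coeff (lpoly_to_poly f) n = Poly_Mapping.lookup f (int n + Min (Poly_Mapping.keys f))"
proof -
  let ?k = "Min (Poly_Mapping.keys f)"
  have "coeff (lpoly_to_poly f) n =
      (\<Sum>i\<in>Poly_Mapping.keys f. if i = int n + ?k then Poly_Mapping.lookup f i else 0)"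
    unfolding lpoly_to_poly_def coeff_sum
  proof (intro sum.cong refl)
    fix i assume "i \<in> Poly_Mapping.keys f"
    then have "?k \<le> i" by simp
    then have "nat (i - ?k) = n \<longleftrightarrow> i = int n + ?k" by auto
    then show "coeff (monom (Poly_Mapping.lookup f i) (nat (i - ?k))) n =
        (if i = int n + ?k then Poly_Mapping.lookup f i else 0)"
      by (simp add: coeff_monom)
  qed
  also have "\<dots> = Poly_Mapping.lookup f (int n + ?k)"
    by (auto simp: sum.delta' in_keys_iff)
  finally show ?thesis .
qed

lemma lpoly_of_lpoly_to_poly:
  "f = Poly_Mapping.single (Min (Poly_Mapping.keys f)) 1 * lpoly_of_poly (lpoly_to_poly f)"
proof (rule poly_mapping_eqI)
  fix j
  have "Poly_Mapping.lookup f j = 0" if "j < Min (Poly_Mapping.keys f)"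
    using that by (metis Min_le finite_keys in_keys_iff not_less)
  then show "Poly_Mapping.lookup f j = Poly_Mapping.lookup
      (Poly_Mapping.single (Min (Poly_Mapping.keys f)) 1 * lpoly_of_poly (lpoly_to_poly f)) j"
    by (auto simp: lookup_single_mult lookup_lpoly_of_poly coeff_lpoly_to_poly)
qed

text \<open>The shift in \<open>lpoly_to_poly\<close> makes the constant term non-zero, so all roots
  are non-zero and the fundamental theorem of algebra yields exactly the factors listed, up to a
  monomial.\<close>

lemma lpoly_decompose:
  assumes "f \<noteq> 0"
  shows "\<exists>k a. a \<noteq> 0 \<and> f = Poly_Mapping.single k a *
    (\<Prod>c\<in>{c. c \<noteq> 0 \<and> poly (lpoly_to_poly f) c = 0}.
      (lpoly_X - lpoly_const c) ^ Polynomial.order c (lpoly_to_poly f))"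
proof -
  let ?r = "lpoly_to_poly f" and ?k = "Min (Poly_Mapping.keys f)"
  have "?k \<in> Poly_Mapping.keys f" using assms by (intro Min_in) auto
  then have "coeff ?r 0 \<noteq> 0" by (simp add: coeff_lpoly_to_poly in_keys_iff)
  then have r0: "?r \<noteq> 0" "{c. c \<noteq> 0 \<and> poly ?r c = 0} = {c. poly ?r c = 0}"
    by (auto simp: poly_0_coeff_0)
  have "f = Poly_Mapping.single ?k 1 * lpoly_of_poly ?r" by (rule lpoly_of_lpoly_to_poly)
  also have "lpoly_of_poly ?r = lpoly_of_poly (smult (lead_coeff ?r)
      (\<Prod>c | poly ?r c = 0. [:- c, 1:] ^ Polynomial.order c ?r))"
    by (simp only: complex_poly_decompose)
  also have "\<dots> = Poly_Mapping.single 0 (lead_coeff ?r) *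
      (\<Prod>c | poly ?r c = 0. (lpoly_X - lpoly_const c) ^ Polynomial.order c ?r)"
    by (simp only: lpoly_of_poly_smult lpoly_of_poly_prod lpoly_of_poly_power lpoly_of_poly_linear)
  also have "Poly_Mapping.single ?k 1 * \<dots> = Poly_Mapping.single ?k (lead_coeff ?r) *
      (\<Prod>c | poly ?r c = 0. (lpoly_X - lpoly_const c) ^ Polynomial.order c ?r)"
    by (simp add: mult.assoc[symmetric] mult_single)
  finally have "f = Poly_Mapping.single ?k (lead_coeff ?r) *
      (\<Prod>c | poly ?r c = 0. (lpoly_X - lpoly_const c) ^ Polynomial.order c ?r)" .
  moreover have "lead_coeff ?r \<noteq> 0" using r0(1) by simp
  ultimately show ?thesis unfolding r0(2) by blast
qed

text \<open>The product is monic of degree \<open>\<Sum>i\<in>A. m i\<close>, and its value at 0 is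
  non-zero because no \<open>c i\<close> is 0. These two coefficients give the ends of the segment
  in the Newton polygon of \<open>R\<close>.\<close>

lemma lookup_prod_linear:
  fixes c :: "'a \<Rightarrow> complex" and m :: "'a \<Rightarrow> nat"
  assumes "finite A" "\<And>i. i \<in> A \<Longrightarrow> c i \<noteq> 0"
  defines "f \<equiv> \<Prod>i\<in>A. (lpoly_X - lpoly_const (c i)) ^ m i"
  shows "Poly_Mapping.lookup f 0 \<noteq> 0" "Poly_Mapping.lookup f (int (\<Sum>i\<in>A. m i)) \<noteq> 0"
proof -
  let ?r = "\<Prod>i\<in>A. [:- c i, 1:] ^ m i"
  have f: "f = lpoly_of_poly ?r"
    by (simp add: f_def lpoly_of_poly_prod lpoly_of_poly_power lpoly_of_poly_linear)
  have "degree ?r = (\<Sum>i\<in>A. m i)"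
    by (subst degree_prod_sum_eq) (auto simp: degree_power_eq)
  moreover have "?r \<noteq> 0" using assms(1) by simp
  ultimately show "Poly_Mapping.lookup f (int (\<Sum>i\<in>A. m i)) \<noteq> 0"
    unfolding f lookup_lpoly_of_poly by (metis leading_coeff_0_iff nat_int of_nat_0_le_iff)
  have "poly ?r 0 \<noteq> 0" using assms by (simp add: poly_prod)
  then show "Poly_Mapping.lookup f 0 \<noteq> 0"
    unfolding f lookup_lpoly_of_poly by (simp add: poly_0_coeff_0)
qed

section \<open>Newton polygons\<close>

text \<open>The generators are invariant only under integral upward translations. The point raised
  by an integer \<open>n \<ge> t\<close> is therefore in the polygon, and the point raised by
  \<open>t\<close> follows by convexity.\<close>

lemma newton_polygon_upward:
  assumes "(x, y) \<in> newton_polygon P" "t \<ge> 0"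
  shows "(x, y + t) \<in> newton_polygon P"
proof -
  let ?G = "{(real_of_int i, real_of_int j) | i j.
       Poly_Mapping.lookup P i \<noteq> 0 \<and> fls_subdegree (Poly_Mapping.lookup P i) \<le> j}"
  define n where "n = nat \<lceil>t\<rceil>"
  have n: "t \<le> real n" unfolding n_def by (rule real_nat_ceiling_ge)
  have "(+) (0, real n) ` ?G \<subseteq> ?G"
  proof
    fix z assume "z \<in> (+) (0, real n) ` ?G"
    then obtain i j where z: "z = (0, real n) + (real_of_int i, real_of_int j)"
      and ij: "Poly_Mapping.lookup P i \<noteq> 0" "fls_subdegree (Poly_Mapping.lookup P i) \<le> j"
      by blast
    have "(0, real n) + (real_of_int i, real_of_int j) = (real_of_int i, real_of_int (j + int n))"
      by simp
    moreover have "fls_subdegree (Poly_Mapping.lookup P i) \<le> j + int n" using ij by simp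
    ultimately show "z \<in> ?G" using z ij(1) by blast
  qed
  then have "convex hull ((+) (0, real n) ` ?G) \<subseteq> convex hull ?G"
    by (rule hull_mono)
  then have "(+) (0, real n) ` newton_polygon P \<subseteq> newton_polygon P"
    by (simp only: convex_hull_translation newton_polygon_def)
  then have top: "(x, y + real n) \<in> newton_polygon P"
    using assms(1) by force
  have cv: "convex (newton_polygon P)" by (simp add: newton_polygon_def)
  show ?thesis
  proof (cases "n = 0")
    case True
    then show ?thesis using n assms by simp
  next
    case False
    then have "(1 - t / real n) *\<^sub>R (x, y) + (t / real n) *\<^sub>R (x, y + real n) \<in> newton_polygon P"
      using n assms(2) by (intro convexD[OF cv assms(1) top]) (auto simp: field_simps)
    also have "(1 - t / real n) *\<^sub>R (x, y) + (t / real n) *\<^sub>R (x, y + real n) = (x, y + t)"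
      using False by (simp add: distrib_left left_diff_distrib)
    finally show ?thesis .
  qed
qed

lemma convex_newton_polygon: "convex (newton_polygon P)"
  by (simp add: newton_polygon_def)

section \<open>Contact of the polygon with lines of slope \<mu>\<close>

lemma newton_polygon_memI:
  assumes "initial_form q \<mu> l P f" "Poly_Mapping.lookup f i \<noteq> 0"
  shows "(real_of_int i, real_of_int (l + \<mu> * i)) \<in> newton_polygon P"
proof -
  have nz: "fls_nth (Poly_Mapping.lookup P i) (l + \<mu> * i) \<noteq> 0"
    using assms unfolding initial_form_def twisted_coeff_nth by (metis mult_zero_right)
  then have "fls_subdegree (Poly_Mapping.lookup P i) \<le> l + \<mu> * i"
    by (meson fls_subdegree_leI)
  moreover have "Poly_Mapping.lookup P i \<noteq> 0" using nz by auto
  ultimately show ?thesis unfolding newton_polygon_def by (intro hull_inc) blast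
qed

text \<open>By integrality, generators that are not on the line of height \<open>l\<close> are at
  least 1 above it. This gap leaves room for tilting the line.\<close>

lemma initial_form_generator:
  assumes q: "q \<noteq> 0" and P: "initial_form q \<mu> l P f"
    and i: "Poly_Mapping.lookup P i \<noteq> 0" "fls_subdegree (Poly_Mapping.lookup P i) \<le> j"
  shows "l \<le> j - \<mu> * i" "Poly_Mapping.lookup f i = 0 \<Longrightarrow> l + 1 \<le> j - \<mu> * i"
proof -
  let ?n = "fls_subdegree (Poly_Mapping.lookup P i) - \<mu> * i"
  have nz: "fls_nth (twisted_coeff q \<mu> P i) ?n \<noteq> 0"
    using i q by (simp add: twisted_coeff_nth nth_fls_subdegree_nonzero)
  then have n: "\<not> ?n < l" using P unfolding initial_form_def by blast
  with i show "l \<le> j - \<mu> * i" by linarith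
  assume "Poly_Mapping.lookup f i = 0"
  then have "?n \<noteq> l" using nz P by (auto simp: initial_form_def)
  with n i show "l + 1 \<le> j - \<mu> * i" by linarith
qed

lemma newton_polygon_above_line:
  assumes q: "q \<noteq> 0" and P: "initial_form q \<mu> l P f"
    and xy: "(x, y) \<in> newton_polygon P"
  shows "real_of_int l \<le> y - real_of_int \<mu> * x"
proof -
  let ?H = "{z. (- real_of_int \<mu>, 1) \<bullet> z \<ge> real_of_int l}"
  have "newton_polygon P \<subseteq> ?H"
    unfolding newton_polygon_def
  proof (rule hull_minimal)
    show "convex ?H" by (rule convex_halfspace_ge)
    show "{(real_of_int i, real_of_int j) | i j.
       Poly_Mapping.lookup P i \<noteq> 0 \<and> fls_subdegree (Poly_Mapping.lookup P i) \<le> j} \<subseteq> ?H"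
    proof clarify
      fix i j assume "Poly_Mapping.lookup P i \<noteq> 0" "fls_subdegree (Poly_Mapping.lookup P i) \<le> j"
      from initial_form_generator(1)[OF q P this]
      have "real_of_int l \<le> real_of_int (j - \<mu> * i)" by linarith
      then show "real_of_int l \<le> (- real_of_int \<mu>, 1) \<bullet> (real_of_int i, real_of_int j)" by simp
    qed
  qed
  with xy have "(x, y) \<in> ?H" by blast
  then show ?thesis by simp
qed

text \<open>The line of slope \<mu> can be tilted slightly in both directions about its point over
  \<open>k\<close> and still stay below all generators. A point of the polygon on the untilted line
  must then lie over \<open>k\<close>.\<close>

lemma newton_polygon_vertex:
  assumes q: "q \<noteq> 0" and P: "initial_form q \<mu> l P (Poly_Mapping.single k a)"
    and xy: "(x, y) \<in> newton_polygon P" and eq: "y - real_of_int \<mu> * x = real_of_int l"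
  shows "x = real_of_int k"
proof -
  \<comment> \<open>The tilts change the slope by \<open>1 / D\<close>. As \<open>D\<close> bounds
    the distance of every index of the support from \<open>k\<close>, the tilted lines rise by at
    most 1, the gap available; the summand 1 keeps \<open>D\<close> positive.\<close>
  define D where "D = 1 + (\<Sum>i\<in>Poly_Mapping.keys P. \<bar>real_of_int (i - k)\<bar>)"
  have D: "D > 0" unfolding D_def by (intro add_pos_nonneg sum_nonneg) auto
  have le_D: "\<bar>real_of_int (i - k)\<bar> \<le> D" if "Poly_Mapping.lookup P i \<noteq> 0" for i
  proof -
    have "\<bar>real_of_int (i - k)\<bar> \<le> (\<Sum>i\<in>Poly_Mapping.keys P. \<bar>real_of_int (i - k)\<bar>)"
      using that by (intro member_le_sum) (auto simp: in_keys_iff)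
    then show ?thesis by (simp add: D_def)
  qed
  let ?H = "{z. (- real_of_int \<mu> - 1 / D, 1) \<bullet> z \<ge> real_of_int l - real_of_int k / D} \<inter>
    {z. (- real_of_int \<mu> + 1 / D, 1) \<bullet> z \<ge> real_of_int l + real_of_int k / D}"
  have "newton_polygon P \<subseteq> ?H"
    unfolding newton_polygon_def
  proof (rule hull_minimal)
    show "convex ?H" by (intro convex_Int convex_halfspace_ge)
    show "{(real_of_int i, real_of_int j) | i j.
       Poly_Mapping.lookup P i \<noteq> 0 \<and> fls_subdegree (Poly_Mapping.lookup P i) \<le> j} \<subseteq> ?H"
    proof clarify
      fix i j assume ij: "Poly_Mapping.lookup P i \<noteq> 0" "fls_subdegree (Poly_Mapping.lookup P i) \<le> j"
      have "\<bar>real_of_int i - real_of_int k\<bar> / D \<le> real_of_int (j - \<mu> * i) - real_of_int l"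
      proof (cases "i = k")
        case True
        moreover have "real_of_int l \<le> real_of_int (j - \<mu> * i)"
          using initial_form_generator(1)[OF q P ij] by linarith
        ultimately show ?thesis by simp
      next
        case False
        then have "l + 1 \<le> j - \<mu> * i"
          by (intro initial_form_generator(2)[OF q P ij]) (simp add: lookup_single)
        then have "1 \<le> real_of_int (j - \<mu> * i) - real_of_int l" by linarith
        moreover have "\<bar>real_of_int i - real_of_int k\<bar> / D \<le> 1"
          using D le_D[OF ij(1)] by simp
        ultimately show ?thesis by linarith
      qed
      moreover have "(real_of_int i - real_of_int k) / D \<le> \<bar>real_of_int i - real_of_int k\<bar> / D"
        "- ((real_of_int i - real_of_int k) / D) \<le> \<bar>real_of_int i - real_of_int k\<bar> / D"
        using D by (auto intro: divide_right_mono simp add: minus_divide_left)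
      ultimately show "(real_of_int i, real_of_int j) \<in> ?H"
        by (simp add: diff_divide_distrib algebra_simps)
    qed
  qed
  with xy have "(x, y) \<in> ?H" by blast
  then have "x / D \<le> real_of_int k / D" "real_of_int k / D \<le> x / D"
    using eq by (simp_all add: algebra_simps)
  then show ?thesis using D by (simp add: divide_le_cancel)
qed

text \<open>If \<open>(a, b)\<close> were below the line of the edge, the segment from \<open>(a, b)\<close> through the midpoint
  of the edge could be prolonged inside \<open>N\<close>, against the face property.\<close>

lemma edge_supports:
  assumes up: "\<And>a b t. (a, b) \<in> N \<Longrightarrow> 0 \<le> t \<Longrightarrow> (a, b + t) \<in> N"
    and face: "closed_segment (x, y) (x + r, y + d) face_of N" and r: "(r::real) > 0"
    and ab: "(a, b) \<in> N"
  shows "y * r - x * d \<le> b * r - a * (d::real)"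
proof (rule ccontr)
  assume "\<not> ?thesis"
  then have less: "b * r - a * d < y * r - x * d" by simp
  define w where "w = x + r / 2"
  define h where "h = y + d / 2"
  \<comment> \<open>The segment from \<open>(a, b)\<close> to the midpoint \<open>(w, h)\<close> is
    prolonged by the factor \<open>e = r / (2 * k)\<close>. This \<open>k\<close> limits the
    horizontal shift to \<open>r / 2\<close>, so the new end stays over the edge; the summand 1
    covers \<open>a = w\<close>.\<close>
  define k where "k = \<bar>w - a\<bar> + 1"
  have k: "k > 0" by (simp add: k_def)
  define e where "e = r / (2 * k)"
  have e: "e > 0" using r k by (simp add: e_def)
  have "e * \<bar>w - a\<bar> \<le> e * k" using e by (simp add: k_def)
  also have "\<dots> = r / 2" using k by (simp add: e_def)
  finally have ew: "e * \<bar>w - a\<bar> \<le> r / 2" .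
  have "\<bar>e * (w - a)\<bar> \<le> r / 2" using ew e by (simp add: abs_mult)
  then have ew': "- (r / 2) \<le> e * (w - a)" "e * (w - a) \<le> r / 2" by linarith+
  \<comment> \<open>The parameter of the point of the edge with the same abscissa as the prolonged
    end. By \<open>less\<close> that end lies above this point, hence in \<open>N\<close> by upward
    closure.\<close>
  define s where "s = 1 / 2 + e * (w - a) / r"
  have s: "0 \<le> s" "s \<le> 1" using ew' r by (simp_all add: s_def field_simps)
  have sub: "closed_segment (x, y) (x + r, y + d) \<subseteq> N" using face by (rule face_of_imp_subset)
  have "(x + s * r, y + s * d) \<in> closed_segment (x, y) (x + r, y + d)"
    using s by (auto simp: in_segment algebra_simps intro!: exI[of _ s])
  then have base: "(x + s * r, y + s * d) \<in> N" using sub by blast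
  have lift: "h + e * (h - b) - (y + s * d) = e / r * ((y * r - x * d) - (b * r - a * d))"
    using r by (simp add: s_def h_def w_def field_simps)
  have "h + e * (h - b) - (y + s * d) \<ge> 0"
    unfolding lift using e r less by simp
  moreover have "x + s * r = w + e * (w - a)"
    using r by (simp add: s_def w_def distrib_right)
  ultimately have top: "(w + e * (w - a), h + e * (h - b)) \<in> N"
    using up[OF base, of "h + e * (h - b) - (y + s * d)"] by simp
  have mid: "(w, h) \<in> closed_segment (x, y) (x + r, y + d)"
    by (auto simp: in_segment w_def h_def algebra_simps intro!: exI[of _ "1/2"])
  have ne: "(a, b) \<noteq> (w, h)"
    using less by (auto simp: w_def h_def algebra_simps)
  \<comment> \<open>The weight with \<open>g * (1 + e) = 1\<close>, for which the midpoint is the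
    convex combination of \<open>(a, b)\<close> and the prolonged end.\<close>
  define g where "g = 1 / (1 + e)"
  have g: "0 < g" "g < 1" using e by (simp_all add: g_def)
  have ge: "g * e = 1 - g" using e by (simp add: g_def field_simps)
  have "(1 - g) * a' + g * (v + e * (v - a')) = v" for a' v
  proof -
    have "(1 - g) * a' + g * (v + e * (v - a')) = (1 - g) * a' + g * v + g * e * (v - a')"
      by (simp add: distrib_left)
    also have "\<dots> = v" unfolding ge by (simp add: algebra_simps)
    finally show ?thesis .
  qed
  then have "(w, h) = (1 - g) *\<^sub>R (a, b) + g *\<^sub>R (w + e * (w - a), h + e * (h - b))"
    by simp
  moreover have "(a, b) \<noteq> (w + e * (w - a), h + e * (h - b))"
  proof
    assume "(a, b) = (w + e * (w - a), h + e * (h - b))"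
    then have "(1 + e) * (w - a) = 0" "(1 + e) * (h - b) = 0" by (simp_all add: algebra_simps)
    with e ne show False by simp
  qed
  ultimately have "(w, h) \<in> open_segment (a, b) (w + e * (w - a), h + e * (h - b))"
    using g unfolding in_segment by blast
  then have "(a, b) \<in> closed_segment (x, y) (x + r, y + d)"
    using face ab top mid unfolding face_of_def by blast
  then obtain v where "a = x + v * r" "b = y + v * d"
    by (auto simp: in_segment algebra_simps)
  with less show False by (simp add: algebra_simps)
qed

lemma newton_vectors_supports:
  assumes "closed_segment (x, y) (x + real r, y + real_of_int d) edge_of newton_polygon P" "r > 0"
    and "(a, b) \<in> newton_polygon P"
  shows "y * real r - x * real_of_int d \<le> b * real r - a * real_of_int d"
  using assms by (intro edge_supports[of "newton_polygon P"])
    (auto simp: edge_of_def newton_polygon_upward)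

lemma segment_newton_polygonD:
  assumes "closed_segment (x, y) (x + real r, y + real_of_int d) edge_of newton_polygon P"
  shows "(x, y) \<in> newton_polygon P" "(x + real r, y + real_of_int d) \<in> newton_polygon P"
  using edge_of_imp_subset[OF assms] by auto

text \<open>An edge of slope \<mu> supports the polygon, so it lies on the line of height
  \<open>l\<close>, the lowest one that the polygon reaches. The polygon has only one point on that
  line, but the ends of the edge have different abscissas.\<close>

lemma not_newton_slope:
  assumes q: "q \<noteq> 0" and P: "initial_form q \<mu> l P (Poly_Mapping.single k a)" and a: "a \<noteq> 0"
  shows "of_int \<mu> \<notin> newton_slopes P"
proof
  assume "of_int \<mu> \<in> newton_slopes P"
  then obtain r d x y where r: "r > 0" and eq: "of_int \<mu> = (of_int d / of_nat r :: rat)"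
    and S: "closed_segment (x, y) (x + real r, y + real_of_int d) edge_of newton_polygon P"
    by (auto simp: newton_slopes_def newton_vectors_def)
  from eq r have "(of_int d :: rat) = of_int (\<mu> * int r)" by (simp add: field_simps)
  then have d: "d = \<mu> * int r" by (simp only: of_int_eq_iff)
  note in_N = segment_newton_polygonD[OF S]
  have "(real_of_int k, real_of_int (l + \<mu> * k)) \<in> newton_polygon P"
    using newton_polygon_memI[OF P] a by simp
  from newton_vectors_supports[OF S r this]
  have "(y - real_of_int \<mu> * x) * real r \<le> real_of_int l * real r"
    by (simp add: d algebra_simps)
  then have "y - real_of_int \<mu> * x \<le> real_of_int l" using r by simp
  then have *: "y - real_of_int \<mu> * x = real_of_int l"
    using newton_polygon_above_line[OF q P in_N(1)] by simp
  then have "y + real_of_int d - real_of_int \<mu> * (x + real r) = real_of_int l"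
    by (simp add: d algebra_simps)
  from newton_polygon_vertex[OF q P in_N(1) *] newton_polygon_vertex[OF q P in_N(2) this] r
  show False by simp
qed

text \<open>The line of slope \<open>d / r\<close> through \<open>(x, y)\<close> passes below or
  through \<open>(0, 0)\<close> and \<open>(M, m * M)\<close>, hence stays below or on the chord
  between them. With the weights \<open>M - x\<close> and \<open>x\<close> the terms containing
  \<open>d\<close> cancel.\<close>

lemma strip_line_below:
  fixes x y r d M m :: real
  assumes "y * r \<le> x * d" "(y - m * M) * r \<le> (x - M) * d" "0 \<le> x" "x \<le> M" "0 < M" "0 < r"
  shows "y \<le> m * x"
proof -
  have "(M - x) * (y * r) + x * ((y - m * M) * r) \<le> (M - x) * (x * d) + x * ((x - M) * d)"
    using assms by (intro add_mono mult_left_mono) auto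
  then have "(M * r) * (y - m * x) \<le> 0" by (simp add: algebra_simps)
  then show ?thesis using assms by (simp add: mult_le_0_iff)
qed

text \<open>The polygon lies over \<open>[0, M]\<close> and above the chord from
  \<open>(0, 0)\<close> to \<open>(M, \<mu> M)\<close>, whose ends belong to it. A non-vertical edge
  supports the polygon at both ends of the chord, which forces it onto the chord; being a face, it
  is then the whole chord.\<close>

lemma newton_fun_single_slope:
  assumes q: "q \<noteq> 0" and P: "initial_form q \<mu> 0 P f"
    and keys: "Poly_Mapping.keys P \<subseteq> {0..int M}"
    and f: "Poly_Mapping.lookup f 0 \<noteq> 0" "Poly_Mapping.lookup f (int M) \<noteq> 0"
  shows "newton_fun P = (\<lambda>\<nu>. if \<nu> = of_int \<mu> then M else 0)"
proof -
  let ?N = "newton_polygon P" and ?m = "real_of_int \<mu>"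
  have o: "(0, 0) \<in> ?N" using newton_polygon_memI[OF P f(1)] by simp
  have e: "(real M, ?m * real M) \<in> ?N" using newton_polygon_memI[OF P f(2)] by simp
  have strip: "0 \<le> x \<and> x \<le> real M" if "(x, y) \<in> ?N" for x y
  proof -
    let ?H = "{z. (1, 0::real) \<bullet> z \<ge> 0} \<inter> {z. (1, 0) \<bullet> z \<le> real M}"
    have "?N \<subseteq> ?H"
      unfolding newton_polygon_def
    proof (rule hull_minimal)
      show "convex ?H" by (intro convex_Int convex_halfspace_ge convex_halfspace_le)
      show "{(real_of_int i, real_of_int j) | i j.
         Poly_Mapping.lookup P i \<noteq> 0 \<and> fls_subdegree (Poly_Mapping.lookup P i) \<le> j} \<subseteq> ?H"
        using keys by (force simp: in_keys_iff)
    qed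
    with that show ?thesis by auto
  qed
  have edge: "r > 0 \<and> r = M \<and> d = \<mu> * int M" if "(r, d) \<in> newton_vectors P" for r d
  proof -
    from that obtain x y where r: "r > 0"
      and S: "closed_segment (x, y) (x + real r, y + real_of_int d) edge_of ?N"
      by (auto simp: newton_vectors_def)
    note in_N = segment_newton_polygonD[OF S]
    have x: "0 \<le> x" "x + real r \<le> real M" using strip[OF in_N(1)] strip[OF in_N(2)] by auto
    have y: "?m * x \<le> y" "?m * (x + real r) \<le> y + real_of_int d"
      using newton_polygon_above_line[OF q P in_N(1)] newton_polygon_above_line[OF q P in_N(2)]
      by auto
    note le = newton_vectors_supports[OF S r o] newton_vectors_supports[OF S r e]
    have "y \<le> ?m * x"
      by (rule strip_line_below[of y "real r" x "real_of_int d" ?m "real M"])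
        (use le x r in \<open>auto simp: algebra_simps\<close>)
    moreover have "y + real_of_int d \<le> ?m * (x + real r)"
      by (rule strip_line_below[of _ "real r" _ "real_of_int d" ?m "real M"])
        (use le x r in \<open>auto simp: algebra_simps\<close>)
    ultimately have y_eq: "y = ?m * x" "real_of_int d = ?m * real r"
      using y by (auto simp: algebra_simps)
    \<comment> \<open>The position of the midpoint of the edge on the chord. It is an inner point of
      the chord, so the face property puts both ends of the chord on the edge.\<close>
    define t where "t = (x + real r / 2) / real M"
    have t: "0 < t" "t < 1" using x r by (auto simp: t_def field_simps)
    have tM: "t * real M = x + real r / 2" using x r by (simp add: t_def)
    have mid: "(t * real M, ?m * (t * real M)) \<in> closed_segment (x, y) (x + real r, y + real_of_int d)"
      unfolding tM by (auto simp: in_segment y_eq algebra_simps intro!: exI[of _ "1/2"])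
    moreover have "(t * real M, ?m * (t * real M)) \<in> open_segment (0, 0) (real M, ?m * real M)"
      using t x r by (auto simp: in_segment zero_prod_def algebra_simps intro!: exI[of _ t])
    ultimately have "(0, 0) \<in> closed_segment (x, y) (x + real r, y + real_of_int d)"
      "(real M, ?m * real M) \<in> closed_segment (x, y) (x + real r, y + real_of_int d)"
      using S o e unfolding edge_of_def face_of_def by blast+
    then obtain u v where "u \<ge> 0" "v \<le> 1" "0 = x + u * real r" "real M = x + v * real r"
      by (auto simp: in_segment algebra_simps)
    moreover from this have "u * real r \<ge> 0" "v * real r \<le> real r"
      using r by (simp_all add: mult_left_le_one_le)
    ultimately have "real r = real M" using x by linarith
    then have "r = M" by simp
    moreover have "real_of_int d = real_of_int (\<mu> * int M)" using y_eq \<open>r = M\<close> by simp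
    then have "d = \<mu> * int M" by (simp only: of_int_eq_iff)
    ultimately show ?thesis using r by simp
  qed
  have mem: "(M, \<mu> * int M) \<in> newton_vectors P" if M: "M > 0"
  proof -
    let ?S = "closed_segment (0, 0) (real M, ?m * real M)"
    have ge: "(- ?m, 1) \<bullet> z \<ge> 0" if "z \<in> ?N" for z
      using newton_polygon_above_line[OF q P, of "fst z" "snd z"] that by (cases z) simp
    \<comment> \<open>The chord is cut out by a supporting line of the polygon, which makes it a
      face.\<close>
    have "?N \<inter> {z. (- ?m, 1) \<bullet> z = 0} = ?S"
    proof (intro equalityI subsetI)
      fix z assume z: "z \<in> ?N \<inter> {z. (- ?m, 1) \<bullet> z = 0}"
      obtain x y where xy: "z = (x, y)" by (cases z)
      have "y = ?m * x" "0 \<le> x" "x \<le> real M" using z strip[of x y] by (auto simp: xy)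
      then show "z \<in> ?S" unfolding xy in_segment using M by (intro exI[of _ "x / real M"]) auto
    next
      fix z assume z: "z \<in> ?S"
      then have "z \<in> ?N" using closed_segment_subset[OF o e convex_newton_polygon] by blast
      with z show "z \<in> ?N \<inter> {z. (- ?m, 1) \<bullet> z = 0}" by (auto simp: in_segment)
    qed
    then have "?S face_of ?N"
      using face_of_Int_supporting_hyperplane_ge[OF convex_newton_polygon ge] by metis
    moreover have "aff_dim ?S = 1"
      using M by (simp add: segment_convex_hull aff_dim_convex_hull aff_dim_2)
    ultimately show ?thesis
      unfolding newton_vectors_def edge_of_def using M
      by (auto intro!: exI[of _ "0::real"])
  qed
  show ?thesis
  proof (cases "M = 0")
    \<comment> \<open>The polygon is now a vertical half-line and has no non-vertical edge.\<close>
    case True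
    have "(r, d) \<notin> newton_vectors P" for r d
      using edge[of r d] True by linarith
    then have "newton_vectors P = {}" by (metis all_not_in_conv surj_pair)
    then show ?thesis unfolding newton_fun_def True by simp
  next
    case False
    then have "newton_vectors P = {(M, \<mu> * int M)}"
      using mem by (auto dest: edge)
    then show ?thesis using False unfolding newton_fun_def by (simp add: fun_eq_iff)
  qed
qed

section \<open>The factorization\<close>

theorem proposition2p4:
  fixes q :: complex and K :: "complex fls set" and P :: qop and \<mu> :: int
    and p :: nat and c :: "nat \<Rightarrow> complex" and m :: "nat \<Rightarrow> nat"
  assumes "norm q > 1"
    and "K = meromorphic_fls \<or> K = germ_fls \<or> K = UNIV"
    and "P \<in> carrier (skew_laurent q K)" and "P \<noteq> 0"
    and "of_int \<mu> \<in> newton_slopes P"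
    and "bij_betw c {1..p} (exponents q \<mu> P)"
    and "\<And>i. i \<in> {1..p} \<Longrightarrow> m i = exponent_mult q \<mu> P (c i)"
    and "\<And>i j l. i \<in> {1..p} \<Longrightarrow> j \<in> {1..p} \<Longrightarrow> l \<ge> (1::nat) \<Longrightarrow> c j / c i = q ^ l \<Longrightarrow> i < j"
  shows "\<exists>Q R Rs (u :: nat \<Rightarrow> nat \<Rightarrow> complex fps).
    Q \<in> carrier (skew_laurent q UNIV) \<and>
    P = Q \<otimes>\<^bsub>skew_laurent q UNIV\<^esub> R \<and>
    of_int \<mu> \<notin> newton_slopes Q \<and>
    R = ordered_prod (skew_laurent q UNIV) (map Rs [1..<Suc p]) \<and>
    (\<forall>i\<in>{1..p}. \<forall>j\<in>{1..m i}. fps_nth (u i j) 0 = 1) \<and>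
    (\<forall>i\<in>{1..p}. Rs i = ordered_prod (skew_laurent q UNIV)
       (map (\<lambda>j. qop_linear \<mu> (c i) \<otimes>\<^bsub>skew_laurent q UNIV\<^esub> qop_const (inverse (fps_to_fls (u i j))))
         (rev [1..<Suc (m i)]))) \<and>
    newton_fun R = (\<lambda>\<nu>. if \<nu> = of_int \<mu> then \<Sum>i\<in>{1..p}. m i else 0) \<and>
    lpoly_eq_upto (char_lpoly q \<mu> R) (\<Prod>i\<in>{1..p}. (lpoly_X - lpoly_const (c i)) ^ m i)"
proof -
  have q: "norm q > 1" "q \<noteq> 0" using assms(1) by auto
  let ?S = "skew_laurent q UNIV"
  define f where "f = (\<Prod>i\<in>{1..p}. (lpoly_X - lpoly_const (c i)) ^ m i)"
  have c: "c i \<noteq> 0" if "i \<in> {1..p}" for i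
    using that bij_betwE[OF assms(6)] by (auto simp: exponents_def)
  \<comment> \<open>Apart from the linear factors of the exponents, the characteristic polynomial is
    a monomial. This unit has no non-zero root and becomes the characteristic polynomial of
    \<open>Q\<close>.\<close>
  obtain k a where a: "a \<noteq> 0" and "char_lpoly q \<mu> P = Poly_Mapping.single k a *
      (\<Prod>x\<in>exponents q \<mu> P. (lpoly_X - lpoly_const x) ^ exponent_mult q \<mu> P x)"
    using lpoly_decompose[OF char_lpoly_nonzero[OF q(2) assms(4), of \<mu>]]
    unfolding exponents_def exponent_mult_def by blast
  moreover have "(\<Prod>x\<in>exponents q \<mu> P. (lpoly_X - lpoly_const x) ^ exponent_mult q \<mu> P x) = f"
    unfolding f_def prod.reindex_bij_betw[OF assms(6), symmetric]
    by (intro prod.cong refl) (simp add: assms(7))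
  ultimately have char: "char_lpoly q \<mu> P = Poly_Mapping.single k a * f" by simp
  have nonroot: "lpoly_eval (Poly_Mapping.single k a) x \<noteq> 0" if "x \<noteq> 0" for x
    using that a by (simp add: lpoly_eval_single)
  have "\<exists>Q u. (\<forall>i\<in>{1..p}. \<forall>j\<in>{1..m i}. fps_nth (u i j) 0 = 1) \<and>
      P = qop_mult q Q
        (qop_prod q (map (\<lambda>i. linear_factor_block q \<mu> (c i) (m i) (u i)) [1..<Suc p])) \<and>
      char_lpoly q \<mu> Q = Poly_Mapping.single k a"
    by (rule split_linear_factor_blocks, fact q(1), fact c, fact assms(4),
        fact char[unfolded f_def], fact nonroot, fact assms(8))
  then obtain Q u where u: "\<forall>i\<in>{1..p}. \<forall>j\<in>{1..m i}. fps_nth (u i j) 0 = 1"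
    and PQ: "P = qop_mult q Q
      (qop_prod q (map (\<lambda>i. linear_factor_block q \<mu> (c i) (m i) (u i)) [1..<Suc p]))"
    and Q: "char_lpoly q \<mu> Q = Poly_Mapping.single k a"
    by blast
  define Rs where "Rs = (\<lambda>i. linear_factor_block q \<mu> (c i) (m i) (u i))"
  define R where "R = qop_prod q (map Rs [1..<Suc p])"
  have slope: "of_int \<mu> \<notin> newton_slopes Q"
    using initial_form_char_lpoly[of q \<mu> Q] a unfolding Q by (rule not_newton_slope[OF q(2)])
  have R: "initial_form q \<mu> 0 R f"
  proof -
    have "initial_form q \<mu> 0 R (\<Prod>i\<leftarrow>[1..<Suc p]. (lpoly_X - lpoly_const (c i)) ^ m i)"
      unfolding R_def Rs_def
      using u by (intro initial_form_qop_prod initial_form_linear_factor_block q) auto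
    also have "(\<Prod>i\<leftarrow>[1..<Suc p]. (lpoly_X - lpoly_const (c i)) ^ m i) = f"
      unfolding f_def by (subst prod.distinct_set_conv_list[symmetric])
        (auto simp: atLeastLessThanSuc_atLeastAtMost simp del: upt_Suc)
    finally show ?thesis .
  qed
  have keys: "Poly_Mapping.keys R \<subseteq> {0..int (\<Sum>i\<in>{1..p}. m i)}"
  proof -
    have "Poly_Mapping.keys R \<subseteq> {0..int (\<Sum>i\<leftarrow>[1..<Suc p]. m i)}"
      unfolding R_def Rs_def by (intro keys_qop_prod keys_linear_factor_block)
    also have "(\<Sum>i\<leftarrow>[1..<Suc p]. m i) = (\<Sum>i\<in>{1..p}. m i)"
      by (subst sum.distinct_set_conv_list[symmetric])
        (auto simp: atLeastLessThanSuc_atLeastAtMost simp del: upt_Suc)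
    finally show ?thesis .
  qed
  have f: "Poly_Mapping.lookup f 0 \<noteq> 0" "Poly_Mapping.lookup f (int (\<Sum>i\<in>{1..p}. m i)) \<noteq> 0"
    unfolding f_def using c by (intro lookup_prod_linear; simp)+
  have "newton_fun R = (\<lambda>\<nu>. if \<nu> = of_int \<mu> then \<Sum>i\<in>{1..p}. m i else 0)"
    by (rule newton_fun_single_slope[OF q(2) R keys f])
  moreover have "lpoly_eq_upto (char_lpoly q \<mu> R) f"
  proof -
    have "f \<noteq> 0" using f(1) by auto
    \<comment> \<open>The identity holds exactly, so the unit in \<open>lpoly_eq_upto\<close> can be
      taken to be 1.\<close>
    from initial_form_unique(2)[OF q(2) R this] have "char_lpoly q \<mu> R = Poly_Mapping.single 0 1 * f"
      by simp
    then show ?thesis unfolding lpoly_eq_upto_def by (metis zero_neq_one)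
  qed
  moreover have "Q \<in> carrier ?S" by (simp add: skew_laurent_def)
  moreover have "P = Q \<otimes>\<^bsub>?S\<^esub> R"
    by (simp only: skew_laurent_mult PQ R_def Rs_def)
  moreover have "\<forall>i\<in>{1..p}. Rs i = ordered_prod ?S
       (map (\<lambda>j. qop_linear \<mu> (c i) \<otimes>\<^bsub>?S\<^esub> qop_const (inverse (fps_to_fls (u i j))))
         (rev [1..<Suc (m i)]))"
    unfolding skew_laurent_mult Rs_def by (intro ballI refl)
  ultimately show ?thesis
    using slope u R_def unfolding f_def
    by (intro exI[of _ Q] exI[of _ R] exI[of _ Rs] exI[of _ u] conjI)
qed

end
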